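(* Let $P$ and $Q$ be finite, non-empty posets such that $P$ is connected. Assume $P^P\cong Q^Q$. Then $Q$ is connected, and therefore $P\cong Q$.
   Context: For a poset $P$, $P^P$ denotes the poset of order-preserving maps $P\to P$, ordered pointwise: $f\le g$ iff $f(p)\le g(p)$ for all $p\in P$. *)

theory Defs
  imports Main
begin

text \<open>A poset is represented by a type with class order; P^P is the set of
  order-preserving maps (mono) with the pointwise order (the library's
  order instance on functions, le_fun_def).\<close>

definition order_preserving_maps :: "('a::order \<Rightarrow> 'a) set" where
  "order_preserving_maps = {f. mono f}"

text \<open>Order isomorphism between two subsets of ordered types.\<close>
definition order_iso_sets :: "'a::ord set \<Rightarrow> 'b::ord set \<Rightarrow> bool" where
  "order_iso_sets A B \<longleftrightarrow>
     (\<exists>h. bij_betw h A B \<and> (\<forall>x\<in>A. \<forall>y\<in>A. h x \<le> h y \<longleftrightarrow> x \<le> y))"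

text \<open>Connected poset: nonempty, and its comparability graph is connected.\<close>
definition poset_connected :: "'a::order set \<Rightarrow> bool" where
  "poset_connected A \<longleftrightarrow> A \<noteq> {} \<and>
     (\<forall>x\<in>A. \<forall>y\<in>A. (x, y) \<in> {(a, b). a \<in> A \<and> b \<in> A \<and> (a \<le> b \<or> b \<le> a)}\<^sup>*)"

end

theory Submission
  imports Defs
begin

text \<open>
Write n and m for the lengths of P and Q. A chain of maximal length in P^P has length n|P|, and
since P is connected, its ends are constant maps. Hence n|P| = m|Q|, and the interval of Q^Q between
the constants at the ends v, w of a longest chain in Q corresponds to an interval of P^P between
constants u, u'. With U = [u, u'] and V = [v, w] this reads U^P = V^Q. The elements of U^P with a
largest element strictly below them are the step functions, so they form J(U) \<times> P^op, and likewise
J(V) \<times> Q^op. Layers of a Cartesian product of cover graphs are convex, so comparing the two product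
structures gives, for each component K of Q, decompositions P = Y^op \<times> Z and K = X^op \<times> Z. If |Z| is
chosen maximal, then every nontrivial direct factor of V has length at least |Y|.

Apply this to the component K of Q that contains V. If X were nontrivial, its length would be at
least |Y|, which contradicts n|P| = m|Q|. So P = Y^op \<times> K, and V is an interval of P. For any
other component K' of Q with its decomposition P = Y'^op \<times> Z', the Y'-part of V is trivial, as |Y'|
exceeds the length of Y'. Hence Z' and K' have length m. But the constants on bottoms of
longest chains all lie in one component of Q^Q, as they do in P^P, so K' = K. Thus Q is connected,
and comparing sizes and lengths in P = Y^op \<times> Q leaves |Y| = 1.
\<close>


section \<open>Strict chains and the length of a poset\<close>

definition ltr :: "'a::order set \<Rightarrow> ('a \<times> 'a) set" where
  "ltr A = {(x, y). x \<in> A \<and> y \<in> A \<and> x < y}"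

lemma relpow_map:
  assumes "\<And>x y. (x, y) \<in> R \<Longrightarrow> (f x, f y) \<in> S"
  shows "(x, y) \<in> R ^^ n \<Longrightarrow> (f x, f y) \<in> S ^^ n"
  by (induction n arbitrary: y) (use assms in \<open>auto\<close>)

lemma relpow_trans: "(x, y) \<in> R ^^ m \<Longrightarrow> (y, z) \<in> R ^^ n \<Longrightarrow> (x, z) \<in> R ^^ (m + n)"
  by (auto simp: relpow_add)

lemma ltr_relpow_le: "(x, y) \<in> ltr A ^^ n \<Longrightarrow> x \<le> y"
proof (induction n arbitrary: y)
  case (Suc n)
  then show ?case by (force simp: ltr_def)
qed simp

lemma ltr_relpow_closed: "(x, y) \<in> ltr A ^^ n \<Longrightarrow> x \<in> A \<Longrightarrow> y \<in> A"
  by (cases n) (auto simp: ltr_def)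

text \<open>Along the chain the sets of elements strictly below its points grow strictly, and the
  last of them still misses \<open>y\<close>.\<close>

lemma ltr_relpow_less_card:
  assumes "finite A" "(x, y) \<in> ltr A ^^ n" "x \<in> A"
  shows "n < card A"
proof -
  have *: "n \<le> card {z \<in> A. z < y}" if "(x, y) \<in> ltr A ^^ n" for n y
    using that
  proof (induction n arbitrary: y)
    case (Suc n)
    then obtain z where z: "(x, z) \<in> ltr A ^^ n" "z \<in> A" "y \<in> A" "z < y"
      by (auto simp: ltr_def)
    have "{w \<in> A. w < z} \<subset> {w \<in> A. w < y}"
      using z by (auto intro: less_trans)
    then have "card {w \<in> A. w < z} < card {w \<in> A. w < y}"
      using \<open>finite A\<close> by (intro psubset_card_mono) auto
    with Suc.IH[OF z(1)] show ?case by simp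
  qed simp
  have "{z \<in> A. z < y} \<subset> A" using ltr_relpow_closed[OF assms(2,3)] by auto
  then have "card {z \<in> A. z < y} < card A" by (rule psubset_card_mono[OF \<open>finite A\<close>])
  with *[OF assms(2)] show ?thesis by simp
qed

text \<open>Length counts steps, not points, so a nonempty antichain has length 0. The condition
  \<open>x \<in> A\<close> is explicit because \<open>ltr A ^^ 0\<close> is the identity on the
  whole type.\<close>

definition has_length :: "'a::order set \<Rightarrow> nat \<Rightarrow> bool" where
  "has_length A n \<longleftrightarrow> (\<exists>x\<in>A. \<exists>y. (x, y) \<in> ltr A ^^ n) \<and>
     (\<forall>k. \<forall>x\<in>A. \<forall>y. (x, y) \<in> ltr A ^^ k \<longrightarrow> k \<le> n)"

lemma has_length_exists:
  assumes "finite A" "A \<noteq> {}"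
  obtains n where "has_length A n"
proof -
  let ?P = "\<lambda>n. \<exists>x\<in>A. \<exists>y. (x, y) \<in> ltr A ^^ n"
  have 0: "?P 0" using assms(2) by auto
  have b: "\<forall>n. ?P n \<longrightarrow> n \<le> card A"
    using ltr_relpow_less_card[OF assms(1)] by (meson less_imp_le)
  have "has_length A (Greatest ?P)"
    unfolding has_length_def
    using GreatestI_nat[of ?P, OF 0 b[rule_format]] Greatest_le_nat[of ?P, OF _ b[rule_format]] by blast
  then show ?thesis by (rule that)
qed

lemma has_length_le: "has_length A n \<Longrightarrow> x \<in> A \<Longrightarrow> (x, y) \<in> ltr A ^^ k \<Longrightarrow> k \<le> n"
  by (auto simp: has_length_def)

lemma has_length_less_card: "has_length A n \<Longrightarrow> finite A \<Longrightarrow> n < card A"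
  using ltr_relpow_less_card by (auto simp: has_length_def)

section \<open>Chains of maps\<close>

abbreviation (input) opm :: "('a::order \<Rightarrow> 'a) set" where "opm \<equiv> order_preserving_maps"

lemma opm_iff [simp]: "f \<in> opm \<longleftrightarrow> mono f"
  by (simp add: order_preserving_maps_def)

lemma mono_const [simp]: "mono (\<lambda>_. c)"
  by (simp add: mono_def)

lemma finite_has_maximal_elem:
  assumes "finite A" "A \<noteq> {}"
  obtains m :: "'a::order" where "m \<in> A" "\<And>x. x \<in> A \<Longrightarrow> \<not> m < x"
  using finite_has_maximal[OF assms] by (metis less_le)

text \<open>Raising one value at a time, at a maximal point of disagreement.\<close>
lemma maps_chain:
  fixes f g :: "'a::order \<Rightarrow> 'a"
  assumes fin: "finite (UNIV :: 'a set)" and "mono f" "mono g" "f \<le> g"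
  shows "(f, g) \<in> ltr opm ^^ card {p. f p \<noteq> g p}"
  using assms(2,4)
proof (induction "card {p. f p \<noteq> g p}" arbitrary: f)
  case 0
  then have "{p. f p \<noteq> g p} = {}"
    using finite_subset[OF subset_UNIV fin] by (metis card_eq_0_iff)
  then have "f = g" by auto
  then show ?case by simp
next
  case (Suc k)
  have finD: "finite {p. f p \<noteq> g p}" by (rule finite_subset[OF subset_UNIV fin])
  have "{p. f p \<noteq> g p} \<noteq> {}" using Suc.hyps(2) by (metis card.empty nat.distinct(1))
  from finite_has_maximal_elem[OF finD this] obtain p where
    p: "f p \<noteq> g p" "\<And>x. f x \<noteq> g x \<Longrightarrow> \<not> p < x" by auto
  let ?f = "f(p := g p)"
  have fg: "\<And>x. f x \<le> g x" using \<open>f \<le> g\<close> by (simp add: le_fun_def)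
  have m: "mono ?f"
  proof (rule monoI)
    fix x y :: 'a assume "x \<le> y"
    then have "f y = g y" if "x = p" "y \<noteq> p" using p(2)[of y] that by (auto simp: less_le)
    then show "?f x \<le> ?f y"
      using fg[of x] monoD[OF \<open>mono g\<close> \<open>x \<le> y\<close>] monoD[OF \<open>mono f\<close> \<open>x \<le> y\<close>]
      by (auto intro: order_trans)
  qed
  have le: "?f \<le> g" using fg by (simp add: le_fun_def)
  have "{x. ?f x \<noteq> g x} = {p. f p \<noteq> g p} - {p}" by auto
  then have "k = card {x. ?f x \<noteq> g x}" using Suc.hyps(2) p(1) finD by simp
  from Suc.hyps(1)[OF this m le] have 1: "(?f, g) \<in> ltr opm ^^ k" using \<open>k = _\<close> by simp
  have "f < ?f" using fg[of p] p(1) by (auto simp: less_fun_def le_fun_def)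
  then have "(f, ?f) \<in> ltr opm" using m Suc.prems by (simp add: ltr_def)
  from relpow_Suc_I2[OF this 1] show ?case using Suc.hyps(2) by simp
qed

text \<open>Distinct constant maps differ at every point, so \<open>maps_chain\<close> refines each
  step of the given chain into as many steps as the poset has points.\<close>

lemma const_maps_chain:
  fixes u w :: "'a::order"
  assumes fin: "finite (UNIV :: 'a set)" and "(u, w) \<in> ltr UNIV ^^ n"
  shows "((\<lambda>_. u) :: 'a \<Rightarrow> 'a, \<lambda>_. w) \<in> ltr opm ^^ (n * card (UNIV :: 'a set))"
  using assms(2)
proof (induction n arbitrary: w)
  case (Suc n)
  then obtain z where z: "(u, z) \<in> ltr UNIV ^^ n" "z < w" by (auto simp: ltr_def)
  have "((\<lambda>_. z) :: 'a \<Rightarrow> 'a, \<lambda>_. w) \<in> ltr opm ^^ card {p::'a. z \<noteq> w}"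
    by (rule maps_chain[OF fin]) (use z in \<open>auto simp: le_fun_def\<close>)
  also have "{p::'a. z \<noteq> w} = UNIV" using z by auto
  finally show ?case using relpow_trans[OF Suc.IH[OF z(1)]] by (simp add: add.commute)
qed simp

text \<open>The sum of the heights of the values increases strictly along a chain of maps and lies
  between 0 and n|P|. A chain of length n|P| therefore starts at sum 0, where all values are
  minimal, and ends with all values of height n, hence maximal.\<close>

lemma maps_chain_bound:
  fixes f g :: "'a::order \<Rightarrow> 'a"
  assumes fin: "finite (UNIV :: 'a set)" and n: "has_length (UNIV :: 'a set) n"
    and ch: "(f, g) \<in> ltr opm ^^ N"
  shows "N \<le> n * card (UNIV :: 'a set)"
    and "N = n * card (UNIV :: 'a set) \<Longrightarrow> \<not> y < f p"
    and "N = n * card (UNIV :: 'a set) \<Longrightarrow> \<not> g p < y"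
proof -
  \<comment> \<open>\<open>h x\<close> is the height of \<open>x\<close>, the length of a longest
    chain ending there.\<close>
  define h where "h x = Greatest (\<lambda>k. \<exists>z. (z, x) \<in> ltr UNIV ^^ k)" for x :: 'a
  have bound: "k \<le> n" if "(z, x) \<in> ltr UNIV ^^ k" for z x :: 'a and k
    using has_length_le[OF n _ that] by simp
  have h_le: "k \<le> h x" if "(z, x) \<in> ltr UNIV ^^ k" for z x :: 'a and k
    unfolding h_def using that bound by (intro Greatest_le_nat[where b = n]) auto
  have h_ex: "\<exists>z. (z, x) \<in> ltr UNIV ^^ h x" for x :: 'a
    unfolding h_def using bound
    by (intro GreatestI_nat[where b = n and k = 0 and P = "\<lambda>k. \<exists>z. (z, x) \<in> ltr UNIV ^^ k"]) auto
  have h_n: "h x \<le> n" for x using h_ex[of x] bound by blast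
  have h_less: "h x < h y" if "x < y" for x y
  proof -
    obtain z where "(z, x) \<in> ltr UNIV ^^ h x" using h_ex by blast
    then have "(z, y) \<in> ltr UNIV ^^ Suc (h x)" using that by (auto simp: ltr_def)
    from h_le[OF this] show ?thesis by simp
  qed
  have h_mono: "h x \<le> h y" if "x \<le> y" for x y
    using h_less[of x y] that by (auto simp: le_less)
  have pot: "(\<Sum>p\<in>UNIV. h (f p)) + N \<le> (\<Sum>p\<in>UNIV. h (g p))"
    using ch
  proof (induction N arbitrary: g)
    case (Suc N)
    then obtain k where k: "(f, k) \<in> ltr opm ^^ N" "k < g" by (auto simp: ltr_def)
    have kg: "\<And>p. k p \<le> g p" using k(2) by (simp add: less_fun_def le_fun_def)
    obtain p where "k p < g p"
    proof -
      from k(2) obtain p where "\<not> g p \<le> k p" by (auto simp: less_fun_def le_fun_def)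
      then have "k p < g p" using kg[of p] by (auto simp: le_less)
      then show ?thesis by (rule that)
    qed
    then have "(\<Sum>p\<in>UNIV. h (k p)) < (\<Sum>p\<in>UNIV. h (g p))"
      using fin kg h_mono h_less by (intro sum_strict_mono_ex1) blast+
    then show ?case using Suc.IH[OF k(1)] by simp
  qed simp
  have up: "(\<Sum>p\<in>UNIV. h (g p)) \<le> n * card (UNIV :: 'a set)"
    using sum_mono[of UNIV "\<lambda>p. h (g p)" "\<lambda>_. n"] h_n by (simp add: mult.commute)
  show "N \<le> n * card (UNIV :: 'a set)" using pot up by simp
  assume N: "N = n * card (UNIV :: 'a set)"
  then have "(\<Sum>p\<in>UNIV. h (f p)) = 0" using pot up by simp
  then have "h (f p) = 0" using fin by simp
  then show "\<not> y < f p" using h_less by fastforce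
  have g_eq: "h (g p) = n"
  proof (rule ccontr)
    assume "h (g p) \<noteq> n"
    then have "h (g p) < n" using h_n[of "g p"] by simp
    then have "(\<Sum>p\<in>UNIV. h (g p)) < (\<Sum>p\<in>(UNIV :: 'a set). n)"
      using fin h_n by (intro sum_strict_mono_ex1) auto
    then show False using pot N by (simp add: mult.commute)
  qed
  show "\<not> g p < y" using h_less[of "g p" y] h_n[of y] g_eq by auto
qed

section \<open>Connectedness\<close>

definition conn :: "('a::order \<times> 'a) set" where
  "conn = {(a, b). a \<le> b \<or> b \<le> a}\<^sup>*"

lemma poset_connected_UNIV: "poset_connected (UNIV :: 'a::order set) \<longleftrightarrow> (\<forall>x y :: 'a. (x, y) \<in> conn)"
  by (simp add: poset_connected_def conn_def)

lemma conn_refl [simp]: "(x, x) \<in> conn"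
  by (simp add: conn_def)

lemma conn_trans: "(x, y) \<in> conn \<Longrightarrow> (y, z) \<in> conn \<Longrightarrow> (x, z) \<in> conn"
  by (auto simp: conn_def)

lemma conn_sym: "(x, y) \<in> conn \<Longrightarrow> (y, x) \<in> conn"
  unfolding conn_def by (rule symD[OF sym_rtrancl]) (auto simp: sym_def)

lemma conn_le: "x \<le> y \<Longrightarrow> (x, y) \<in> conn"
  by (auto simp: conn_def)

lemma conn_invariant:
  assumes "(x, y) \<in> conn" and "\<And>a b. a \<le> b \<Longrightarrow> F a = F b"
  shows "F x = F y"
  using assms(1) unfolding conn_def
  by (induction rule: rtrancl_induct) (auto dest: assms(2))

text \<open>All values of \<open>f\<close> are minimal, so \<open>f a \<le> f b\<close> forces
  equality, and connectedness spreads this over the whole poset. Dually, all values of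
  \<open>g\<close> are maximal.\<close>

lemma longest_maps_chain_const:
  fixes f g :: "'a::order \<Rightarrow> 'a"
  assumes fin: "finite (UNIV :: 'a set)" and n: "has_length (UNIV :: 'a set) n"
    and P: "poset_connected (UNIV :: 'a set)" and "mono f" "mono g"
    and ch: "(f, g) \<in> ltr opm ^^ (n * card (UNIV :: 'a set))"
  obtains u w where "f = (\<lambda>_. u)" "g = (\<lambda>_. w)"
proof -
  note b = maps_chain_bound(2,3)[OF fin n ch refl]
  have "f a = f b" if "a \<le> b" for a b
    using monoD[OF \<open>mono f\<close> that] b(1)[of "f a" b] by (auto simp: le_less)
  then have "f = (\<lambda>_. f undefined)"
    using P conn_invariant[of _ undefined f] by (auto simp: poset_connected_UNIV)
  moreover have "g a = g b" if "a \<le> b" for a b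
    using monoD[OF \<open>mono g\<close> that] b(2)[of a "g b"] by (auto simp: le_less)
  then have "g = (\<lambda>_. g undefined)"
    using P conn_invariant[of _ undefined g] by (auto simp: poset_connected_UNIV)
  ultimately show ?thesis by (rule that)
qed

section \<open>Order isomorphisms between sets\<close>

text \<open>The relations are parameters because posets also occur with the reversed order, and
  products with one factor reversed.\<close>

definition oiso :: "('a \<Rightarrow> 'a \<Rightarrow> bool) \<Rightarrow> 'a set \<Rightarrow> ('b \<Rightarrow> 'b \<Rightarrow> bool) \<Rightarrow> 'b set \<Rightarrow> ('a \<Rightarrow> 'b) \<Rightarrow> bool" where
  "oiso r A s B f \<longleftrightarrow> bij_betw f A B \<and> (\<forall>x\<in>A. \<forall>y\<in>A. s (f x) (f y) \<longleftrightarrow> r x y)"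

abbreviation oisole :: "'a::ord set \<Rightarrow> 'b::ord set \<Rightarrow> ('a \<Rightarrow> 'b) \<Rightarrow> bool" where
  "oisole A B f \<equiv> oiso (\<le>) A (\<le>) B f"

lemma order_iso_sets_iff: "order_iso_sets A B \<longleftrightarrow> (\<exists>f. oisole A B f)"
  by (simp add: order_iso_sets_def oiso_def)

text \<open>Injectivity comes from reflexivity of \<open>s\<close> on \<open>B\<close> and
  antisymmetry of \<open>r\<close> on \<open>A\<close>.\<close>

lemma oisoI:
  assumes "\<And>x. x \<in> A \<Longrightarrow> f x \<in> B" "\<And>y. y \<in> B \<Longrightarrow> \<exists>x\<in>A. f x = y"
    "\<And>x y. x \<in> A \<Longrightarrow> y \<in> A \<Longrightarrow> s (f x) (f y) \<longleftrightarrow> r x y"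
    "\<And>x y. x \<in> A \<Longrightarrow> y \<in> A \<Longrightarrow> r x y \<Longrightarrow> r y x \<Longrightarrow> x = y"
    "\<And>y. y \<in> B \<Longrightarrow> s y y"
  shows "oiso r A s B f"
proof -
  have "inj_on f A"
  proof (rule inj_onI)
    fix x y assume "x \<in> A" "y \<in> A" "f x = f y"
    then have "s (f x) (f y)" "s (f y) (f x)" using assms(1,5) by auto
    then show "x = y" using assms(3,4) \<open>x \<in> A\<close> \<open>y \<in> A\<close> by blast
  qed
  moreover have "f ` A = B" using assms(1,2) by force
  ultimately show ?thesis using assms(3) by (simp add: oiso_def bij_betw_def)
qed

lemma oiso_mem: "oiso r A s B f \<Longrightarrow> x \<in> A \<Longrightarrow> f x \<in> B"
  by (auto simp: oiso_def bij_betw_def)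

lemma oiso_le: "oiso r A s B f \<Longrightarrow> x \<in> A \<Longrightarrow> y \<in> A \<Longrightarrow> s (f x) (f y) \<longleftrightarrow> r x y"
  by (simp add: oiso_def)

lemma oiso_eq: "oiso r A s B f \<Longrightarrow> x \<in> A \<Longrightarrow> y \<in> A \<Longrightarrow> f x = f y \<longleftrightarrow> x = y"
  by (auto simp: oiso_def bij_betw_def inj_on_def)

lemma oiso_surj:
  assumes "oiso r A s B f" "y \<in> B"
  obtains x where "x \<in> A" "f x = y"
  using assms by (auto simp: oiso_def bij_betw_def)

lemma oiso_card: "oiso r A s B f \<Longrightarrow> card A = card B"
  by (auto simp: oiso_def intro: bij_betw_same_card)

lemma oiso_comp: "oiso r A s B f \<Longrightarrow> oiso s B t C g \<Longrightarrow> oiso r A t C (g \<circ> f)"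
  unfolding oiso_def by (auto intro: bij_betw_trans simp: bij_betwE)

lemma oiso_inv:
  assumes f: "oiso r A s B f"
  shows "oiso s B r A (inv_into A f)"
proof -
  have b: "bij_betw f A B" using f by (simp add: oiso_def)
  have "r (inv_into A f x) (inv_into A f y) \<longleftrightarrow> s x y" if "x \<in> B" "y \<in> B" for x y
    using that oiso_le[OF f, of "inv_into A f x" "inv_into A f y"] b
    by (simp add: bij_betw_inv_into_right bij_betwE[OF bij_betw_inv_into[OF b]])
  then show ?thesis using bij_betw_inv_into[OF b] by (simp add: oiso_def)
qed

lemma oisole_less: "oisole A B f \<Longrightarrow> x \<in> A \<Longrightarrow> y \<in> A \<Longrightarrow> f x < f y \<longleftrightarrow> x < y"
  for f :: "'a::order \<Rightarrow> 'b::order"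
  using oiso_le[of "(\<le>)" A "(\<le>)" B f x y] oiso_eq[of "(\<le>)" A "(\<le>)" B f x y] by (auto simp: less_le)

lemma oisole_ltr_relpow:
  fixes f :: "'a::order \<Rightarrow> 'b::order"
  assumes "oisole A B f" "(x, y) \<in> ltr A ^^ n"
  shows "(f x, f y) \<in> ltr B ^^ n"
  by (rule relpow_map[OF _ assms(2)])
    (use oisole_less[OF assms(1)] oiso_mem[OF assms(1)] in \<open>auto simp: ltr_def\<close>)

section \<open>Elements with a largest element below them\<close>

text \<open>In a finite lattice these are the join-irreducible elements. The description uses the
  order alone, so isomorphisms preserve it.\<close>

definition JI :: "'a::order set \<Rightarrow> 'a set" where
  "JI S = {x \<in> S. \<exists>y\<in>S. y < x \<and> (\<forall>z\<in>S. z < x \<longrightarrow> z \<le> y)}"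

lemma oisole_JI:
  fixes f :: "'a::order \<Rightarrow> 'b::order"
  assumes f: "oisole A B f" and "x \<in> A"
  shows "f x \<in> JI B \<longleftrightarrow> x \<in> JI A"
proof -
  have B: "B = f ` A" using f by (auto simp: oiso_def bij_betw_def)
  show ?thesis
    using \<open>x \<in> A\<close> by (simp add: JI_def B oisole_less[OF f] oiso_le[OF f] cong: conj_cong)
qed

lemma oisole_JI_restrict:
  fixes f :: "'a::order \<Rightarrow> 'b::order"
  assumes f: "oisole A B f"
  shows "oisole (JI A) (JI B) f"
proof -
  have "f ` JI A = JI B"
  proof
    show "f ` JI A \<subseteq> JI B" using oisole_JI[OF f] by (auto simp: JI_def)
    show "JI B \<subseteq> f ` JI A"
    proof
      fix y assume y: "y \<in> JI B"
      then obtain x where "x \<in> A" "f x = y" using oiso_surj[OF f] by (auto simp: JI_def)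
      then show "y \<in> f ` JI A" using oisole_JI[OF f] y by auto
    qed
  qed
  moreover have "inj_on f (JI A)"
    using f by (auto simp: oiso_def bij_betw_def JI_def intro: inj_on_subset)
  ultimately show ?thesis
    using oiso_le[OF f] by (auto simp: oiso_def bij_betw_def JI_def)
qed

definition ivl_maps :: "'a::order \<Rightarrow> 'a \<Rightarrow> ('a \<Rightarrow> 'a) set" where
  "ivl_maps u w = {f. mono f \<and> (\<forall>x. u \<le> f x \<and> f x \<le> w)}"

definition step :: "'a::order \<Rightarrow> 'a \<times> 'a \<Rightarrow> 'a \<Rightarrow> 'a" where
  "step u a = (\<lambda>x. if snd a \<le> x then fst a else u)"

lemma step_mono: "u \<le> fst a \<Longrightarrow> mono (step u a)"
  by (auto simp: step_def mono_def intro: order_trans)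

lemma step_ivl: "fst a \<in> {u..w} \<Longrightarrow> step u a \<in> ivl_maps u w"
  by (auto simp: ivl_maps_def step_mono) (auto simp: step_def)

text \<open>This is the order of A \<times> B^op. It suits step functions, which grow with their
  value and shrink as their threshold rises.\<close>

definition dle :: "'a::ord \<times> 'b::ord \<Rightarrow> 'a \<times> 'b \<Rightarrow> bool" where
  "dle x y \<longleftrightarrow> fst x \<le> fst y \<and> snd y \<le> snd x"

lemma dle_refl [simp]: "dle x x" for x :: "'a::order \<times> 'b::order"
  by (simp add: dle_def)

lemma dle_antisym: "dle x y \<Longrightarrow> dle y x \<Longrightarrow> x = y" for x y :: "'a::order \<times> 'b::order"
  by (auto simp: dle_def prod_eq_iff intro: antisym)

text \<open>At the point \<open>snd a\<close> the left map has a value above \<open>u\<close>, so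
  the right map must already have jumped there.\<close>

lemma step_le_iff:
  assumes "u < fst a" "u < fst b"
  shows "step u a \<le> step u b \<longleftrightarrow> dle a b"
proof
  assume "step u a \<le> step u b"
  then have "step u a (snd a) \<le> step u b (snd a)" by (simp add: le_fun_def)
  then show "dle a b" using assms by (auto simp: step_def dle_def split: if_splits)
next
  assume "dle a b"
  then show "step u a \<le> step u b"
    using assms by (auto simp: step_def dle_def le_fun_def intro: order_trans)
qed

lemma JI_ivl_gt: "a \<in> JI {u..w} \<Longrightarrow> u < a" for u :: "'a::order"
  by (auto simp: JI_def intro: le_less_trans)

text \<open>Lowering the value at the threshold alone, to the largest element \<open>d\<close> below
  it, gives the largest map strictly below. A smaller map that kept the value at the threshold
  would, by monotonicity, be the step function itself.\<close>

lemma step_JI: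
  assumes a: "fst a \<in> JI {u..w}"
  shows "step u a \<in> JI (ivl_maps u w)"
proof -
  obtain c p where ap: "a = (c, p)" by fastforce
  obtain d where d: "d \<in> {u..w}" "d < c" "\<And>z. z \<in> {u..w} \<Longrightarrow> z < c \<Longrightarrow> z \<le> d"
    using a by (auto simp: JI_def ap)
  have c: "u < c" "c \<le> w" using a JI_ivl_gt by (auto simp: JI_def ap)
  let ?g = "(step u a)(p := d)"
  have "mono ?g"
  proof (rule monoI)
    fix x y :: 'a assume "x \<le> y"
    then show "?g x \<le> ?g y" using d c by (auto simp: step_def ap)
  qed
  then have g: "?g \<in> ivl_maps u w" using d c by (auto simp: ivl_maps_def step_def ap)
  have less: "?g < step u a" using d by (auto simp: less_fun_def le_fun_def step_def ap)
  have big: "z \<le> ?g" if z: "z \<in> ivl_maps u w" "z < step u a" for z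
  proof -
    have zle: "z x \<le> step u a x" for x using z(2) by (simp add: less_fun_def le_fun_def)
    have "z p \<noteq> c"
    proof
      assume "z p = c"
      then have "step u a x \<le> z x" for x
        using z(1) by (auto simp: step_def ap ivl_maps_def mono_def)
      then show False using z(2) by (simp add: less_fun_def le_fun_def)
    qed
    then have "z p \<le> d" using zle[of p] z(1) d(3)[of "z p"] by (auto simp: step_def ap ivl_maps_def)
    then show ?thesis using zle by (simp add: le_fun_def)
  qed
  have "step u a \<in> ivl_maps u w" using c by (intro step_ivl) (auto simp: ap)
  then show ?thesis using g less big by (auto simp: JI_def)
qed

text \<open>Every map is the pointwise supremum of the step functions below it, so one with a largest
  element strictly below it must be a step function itself.\<close>
lemma JI_step:
  assumes f: "f \<in> JI (ivl_maps u w)"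
  obtains a where "fst a \<in> JI {u..w}" "f = step u a"
proof -
  from f obtain g where g: "f \<in> ivl_maps u w" "g \<in> ivl_maps u w" "g < f"
    "\<And>z. z \<in> ivl_maps u w \<Longrightarrow> z < f \<Longrightarrow> z \<le> g" by (auto simp: JI_def)
  have st: "step u (f x, x) \<le> f" "step u (f x, x) \<in> ivl_maps u w" for x
    using g(1) by (auto simp: step_def le_fun_def ivl_maps_def mono_def intro: order_trans)
  obtain p where p: "f = step u (f p, p)" "\<not> f p \<le> g p"
  proof -
    obtain p where p: "\<not> f p \<le> g p" using g(3) by (auto simp: less_fun_def le_fun_def)
    have "\<not> step u (f p, p) \<le> g" using p by (auto simp: le_fun_def step_def)
    then have "f = step u (f p, p)" using g(4)[OF st(2)[of p]] st(1)[of p] by (metis less_le)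
    then show ?thesis using p by (rule that)
  qed
  have gp: "g p < f p" using g(3) p(2) by (auto simp: less_fun_def le_fun_def less_le)
  have val: "f x = (if p \<le> x then f p else u)" for x
    using fun_cong[OF p(1), of x] by (simp add: step_def)
  \<comment> \<open>Since \<open>f\<close> is \<open>u\<close> off the up-set of \<open>p\<close>,
    lowering it at \<open>p\<close> alone keeps it monotone. The result is strictly below
    \<open>f\<close>, hence below \<open>g\<close>.\<close>
  have "z \<le> g p" if z: "z \<in> {u..w}" "z < f p" for z
  proof -
    let ?h = "f(p := z)"
    have "mono ?h"
    proof (rule monoI)
      fix x y :: 'a assume "x \<le> y"
      then show "?h x \<le> ?h y"
        using z val[of x] val[of y] monoD[of f x y] g(1) by (auto simp: ivl_maps_def)
    qed
    then have "?h \<in> ivl_maps u w" using g(1) z by (auto simp: ivl_maps_def)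
    moreover have "?h < f" using z by (auto simp: less_fun_def le_fun_def)
    ultimately have "?h \<le> g" by (rule g(4))
    then show ?thesis by (auto simp: le_fun_def dest: spec[of _ p])
  qed
  then have "f p \<in> JI {u..w}" using g(1,2) gp by (auto simp: JI_def ivl_maps_def)
  then show ?thesis using p(1) that[of "(f p, p)"] by simp
qed

text \<open>Through this, an isomorphism between two intervals of maps becomes one between products
  J(U) \<times> P^op and J(V) \<times> Q^op.\<close>

lemma step_oiso: "oiso dle (JI {u..w} \<times> UNIV) (\<le>) (JI (ivl_maps u w)) (step u)"
proof (rule oisoI)
  fix y assume "y \<in> JI (ivl_maps u w)"
  then show "\<exists>x\<in>JI {u..w} \<times> UNIV. step u x = y" by (metis JI_step UNIV_I mem_Times_iff)
qed (auto simp: step_JI step_le_iff JI_ivl_gt dle_antisym)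

section \<open>Convexity of layers in products\<close>

text \<open>This is the Cartesian product of two graphs, with vertex set
  \<open>J \<times> UNIV\<close>.\<close>

definition box_edges :: "'a set \<Rightarrow> ('a \<times> 'a) set \<Rightarrow> ('b \<times> 'b) set \<Rightarrow> (('a \<times> 'b) \<times> ('a \<times> 'b)) set" where
  "box_edges J E F = {((a, b), (c, d)). a \<in> J \<and> c \<in> J \<and> ((a, c) \<in> E \<and> b = d \<or> a = c \<and> (b, d) \<in> F)}"

lemma box_relpow_snd:
  "a \<in> J \<Longrightarrow> (b, d) \<in> F ^^ l \<Longrightarrow> ((a, b), (a, d)) \<in> box_edges J E F ^^ l"
  by (rule relpow_map[where f = "\<lambda>b. (a, b)" and R = F]) (auto simp: box_edges_def)

lemma box_relpow_fst:
  "E \<subseteq> J \<times> J \<Longrightarrow> (a, c) \<in> E ^^ l \<Longrightarrow> ((a, b), (c, b)) \<in> box_edges J E F ^^ l"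
  by (rule relpow_map[where f = "\<lambda>a. (a, b)" and R = E]) (auto simp: box_edges_def)

text \<open>Sort the steps of the walk by the coordinate that they change.\<close>

lemma box_relpow_split:
  "((a, b), (c, d)) \<in> box_edges J E F ^^ n \<Longrightarrow>
    \<exists>k l. n = k + l \<and> (a, c) \<in> E ^^ k \<and> (b, d) \<in> F ^^ l"
proof (induction n arbitrary: c d)
  case (Suc n)
  then obtain c' d' where 1: "((a, b), (c', d')) \<in> box_edges J E F ^^ n"
    "((c', d'), (c, d)) \<in> box_edges J E F" by auto
  from Suc.IH[OF 1(1)] obtain k l where kl: "n = k + l" "(a, c') \<in> E ^^ k" "(b, d') \<in> F ^^ l" by blast
  from 1(2) consider "(c', c) \<in> E" "d' = d" | "c' = c" "(d', d) \<in> F" by (auto simp: box_edges_def)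
  then show ?case
  proof cases
    case 1
    then show ?thesis using kl by (intro exI[of _ "Suc k"] exI[of _ l]) auto
  next
    case 2
    then show ?thesis using kl by (intro exI[of _ k] exI[of _ "Suc l"]) auto
  qed
qed simp

text \<open>Distances in a Cartesian product of graphs are sums of distances in the factors. So a corner
  (a, d) lies on a geodesic from (a, b) to (c, d), and a layer contains the geodesics between its
  points.\<close>
lemma layer_corner:
  assumes E: "E \<subseteq> J \<times> J" and E': "E' \<subseteq> J' \<times> J'"
    and f: "\<And>x y. (x, y) \<in> box_edges J E F \<Longrightarrow> (f x, f y) \<in> box_edges J' E' F'"
    and g: "\<And>x y. (x, y) \<in> box_edges J' E' F' \<Longrightarrow> (g x, g y) \<in> box_edges J E F"
    and gf: "\<And>x. x \<in> J \<times> UNIV \<Longrightarrow> g (f x) = x"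
    and j: "j \<in> J" and ab: "f (j, p1) = (a, b)" and cd: "f (j, p2) = (c, d)"
    and a: "a \<in> J'" and conn: "(p1, p2) \<in> F\<^sup>*"
  obtains p where "g (a, d) = (j, p)" "(p1, p) \<in> F\<^sup>*"
proof -
  define m where "m = (LEAST m. (p1, p2) \<in> F ^^ m)"
  have ex: "\<exists>m. (p1, p2) \<in> F ^^ m" using conn by (simp add: rtrancl_power)
  have m: "(p1, p2) \<in> F ^^ m" unfolding m_def using LeastI_ex[OF ex] .
  have min: "m \<le> k" if "(p1, p2) \<in> F ^^ k" for k unfolding m_def using that by (rule Least_le)
  have "(f (j, p1), f (j, p2)) \<in> box_edges J' E' F' ^^ m"
    by (rule relpow_map[OF f box_relpow_snd[OF j m]])
  then obtain k l where kl: "m = k + l" "(a, c) \<in> E' ^^ k" "(b, d) \<in> F' ^^ l"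
    unfolding ab cd by (blast dest: box_relpow_split)
  have "(g (a, b), g (a, d)) \<in> box_edges J E F ^^ l"
    by (rule relpow_map[OF g box_relpow_snd[OF a kl(3)]])
  moreover have "g (a, b) = (j, p1)" using gf j ab by (metis SigmaI UNIV_I)
  moreover obtain i p where ip: "g (a, d) = (i, p)" by fastforce
  ultimately obtain l1 l2 where l: "l = l1 + l2" "(j, i) \<in> E ^^ l1" "(p1, p) \<in> F ^^ l2"
    using box_relpow_split by metis
  have "(g (a, d), g (c, d)) \<in> box_edges J E F ^^ k"
    by (rule relpow_map[OF g box_relpow_fst[OF E' kl(2)]])
  moreover have "g (c, d) = (j, p2)" using gf j cd by (metis SigmaI UNIV_I)
  ultimately obtain k1 k2 where k: "k = k1 + k2" "(i, j) \<in> E ^^ k1" "(p, p2) \<in> F ^^ k2"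
    using box_relpow_split ip by metis
  \<comment> \<open>The walk through the corner has m steps in all. Its second coordinate alone
    needs m of them, the distance from \<open>p1\<close> to \<open>p2\<close>, so no step is left
    for leaving the layer.\<close>
  have "m \<le> l2 + k2" using relpow_trans[OF l(3) k(3)] by (rule min)
  then have "l1 = 0" using kl(1) l(1) k(1) by simp
  then have "i = j" using l(2) by simp
  then show ?thesis using ip l(3) that by (simp add: relpow_imp_rtrancl)
qed

section \<open>Cover graphs of posets and of their products\<close>

definition cover_edges :: "'a::order set \<Rightarrow> ('a \<times> 'a) set" where
  "cover_edges A = {(x, y). x \<in> A \<and> y \<in> A \<and>
     (x < y \<and> \<not> (\<exists>z\<in>A. x < z \<and> z < y) \<or> y < x \<and> \<not> (\<exists>z\<in>A. y < z \<and> z < x))}"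

lemma cover_edges_subset: "cover_edges A \<subseteq> A \<times> A"
  by (auto simp: cover_edges_def)

lemma cover_edges_sym: "(x, y) \<in> cover_edges A \<Longrightarrow> (y, x) \<in> cover_edges A"
  by (auto simp: cover_edges_def)

text \<open>A comparability is refined into covers by induction on the number of elements strictly
  between its ends.\<close>

lemma cover_edges_conn:
  assumes fin: "finite (UNIV :: 'a::order set)" and "(x, y) \<in> (conn :: ('a \<times> 'a) set)"
  shows "(x, y) \<in> (cover_edges UNIV)\<^sup>*"
proof -
  let ?E = "cover_edges (UNIV :: 'a set)"
  have lt: "(a, b) \<in> ?E\<^sup>*" if "a < b" for a b
    using that
  proof (induction "card {z. a < z \<and> z < b}" arbitrary: a b rule: less_induct)
    case less
    show ?case
    proof (cases "\<exists>z. a < z \<and> z < b")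
      case False
      then show ?thesis using less.prems by (intro r_into_rtrancl) (auto simp: cover_edges_def)
    next
      case True
      then obtain z where z: "a < z" "z < b" by blast
      have "{w. a < w \<and> w < z} \<subset> {w. a < w \<and> w < b}" using z by (auto intro: less_trans)
      then have 1: "(a, z) \<in> ?E\<^sup>*"
        using z finite_subset[OF subset_UNIV fin] by (intro less.hyps psubset_card_mono)
      have "{w. z < w \<and> w < b} \<subset> {w. a < w \<and> w < b}" using z by (auto intro: less_trans)
      then have "(z, b) \<in> ?E\<^sup>*"
        using z finite_subset[OF subset_UNIV fin] by (intro less.hyps psubset_card_mono)
      with 1 show ?thesis by (rule rtrancl_trans)
    qed
  qed
  have sym: "sym (?E\<^sup>*)" by (rule sym_rtrancl) (auto simp: sym_def intro: cover_edges_sym)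
  have "(a, b) \<in> ?E\<^sup>*" if "a \<le> b \<or> b \<le> a" for a b
    using that lt[of a b] lt[of b a] symD[OF sym] by (auto simp: le_less)
  then have "{(a, b). a \<le> b \<or> b \<le> a}\<^sup>* \<subseteq> (?E\<^sup>*)\<^sup>*" by (intro rtrancl_mono) auto
  then show ?thesis using assms(2) by (auto simp: conn_def)
qed

lemma cover_edges_imp_conn: "(x, y) \<in> (cover_edges A)\<^sup>* \<Longrightarrow> (x, y) \<in> conn"
  unfolding conn_def by (erule rtrancl_mono[THEN subsetD, rotated]) (auto simp: cover_edges_def)

text \<open>The undirected cover graph of \<open>dle\<close> on \<open>S\<close>, written with
  \<open>dle\<close> and equality only, so that isomorphisms visibly preserve it.\<close>

definition dle_edges :: "('a::order \<times> 'b::order) set \<Rightarrow> (('a \<times> 'b) \<times> ('a \<times> 'b)) set" where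
  "dle_edges S = {(x, y). x \<in> S \<and> y \<in> S \<and>
     (x \<noteq> y \<and> dle x y \<and> (\<forall>z\<in>S. dle x z \<and> dle z y \<longrightarrow> z = x \<or> z = y) \<or>
      y \<noteq> x \<and> dle y x \<and> (\<forall>z\<in>S. dle y z \<and> dle z x \<longrightarrow> z = y \<or> z = x))}"

text \<open>The corner \<open>(c, b)\<close> lies between the two pairs, so in a cover it equals one
  of them and only one coordinate changes.\<close>

lemma dle_cover_iff:
  fixes a c :: "'a::order" and b d :: "'b::order"
  assumes J: "a \<in> J" "c \<in> J"
  shows "((a, b) \<noteq> (c, d) \<and> dle (a, b) (c, d) \<and>
      (\<forall>z\<in>J \<times> UNIV. dle (a, b) z \<and> dle z (c, d) \<longrightarrow> z = (a, b) \<or> z = (c, d))) \<longleftrightarrow>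
    (a < c \<and> \<not> (\<exists>z\<in>J. a < z \<and> z < c) \<and> b = d \<or> a = c \<and> d < b \<and> \<not> (\<exists>z. d < z \<and> z < b))"
    (is "?L \<longleftrightarrow> ?R")
proof
  assume L: ?L
  then have le: "a \<le> c" "d \<le> b" by (auto simp: dle_def)
  have gap: "(x, y) = (a, b) \<or> (x, y) = (c, d)" if "x \<in> J" "a \<le> x" "x \<le> c" "d \<le> y" "y \<le> b" for x y
    using L that by (simp add: dle_def)
  from gap[of c b] J le consider "a = c" | "b = d" by auto
  then show ?R
  proof cases
    case 1
    moreover have "d < b" using L 1 le by (auto simp: less_le)
    moreover have "\<not> (d < z \<and> z < b)" for z
      using gap[of a z] J 1 by (auto simp: less_le)
    ultimately show ?R by blast
  next
    case 2
    moreover have "a < c" using L 2 le by (auto simp: less_le)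
    moreover have "\<not> (a < z \<and> z < c)" if "z \<in> J" for z
      using gap[of z b] that 2 by (auto simp: less_le)
    ultimately show ?R by blast
  qed
next
  assume ?R
  then show ?L
  proof (elim disjE conjE)
    assume "a < c" "\<not> (\<exists>z\<in>J. a < z \<and> z < c)" "b = d"
    then show ?L by (auto simp: dle_def less_le dest: antisym)
  next
    assume "a = c" "d < b" "\<not> (\<exists>z. d < z \<and> z < b)"
    then show ?L by (auto simp: dle_def less_le dest: antisym)
  qed
qed

text \<open>Order isomorphisms of such products thus act on Cartesian products of graphs, where
  \<open>layer_corner\<close> applies.\<close>

lemma dle_edges_box: "dle_edges (J \<times> UNIV) = box_edges J (cover_edges J) (cover_edges UNIV)"
proof -
  have "(x, y) \<in> dle_edges (J \<times> UNIV) \<longleftrightarrow> (x, y) \<in> box_edges J (cover_edges J) (cover_edges UNIV)"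
    for x y :: "'a \<times> 'b"
  proof -
    obtain a b c d where xy: "x = (a, b)" "y = (c, d)" by fastforce
    show ?thesis
    proof (cases "a \<in> J \<and> c \<in> J")
      case True
      have "(x, y) \<in> dle_edges (J \<times> UNIV) \<longleftrightarrow>
          ((a, b) \<noteq> (c, d) \<and> dle (a, b) (c, d) \<and>
            (\<forall>z\<in>J \<times> UNIV. dle (a, b) z \<and> dle z (c, d) \<longrightarrow> z = (a, b) \<or> z = (c, d))) \<or>
          ((c, d) \<noteq> (a, b) \<and> dle (c, d) (a, b) \<and>
            (\<forall>z\<in>J \<times> UNIV. dle (c, d) z \<and> dle z (a, b) \<longrightarrow> z = (c, d) \<or> z = (a, b)))"
        unfolding dle_edges_def xy mem_Collect_eq case_prod_conv
        using True by (simp only: mem_Times_iff fst_conv snd_conv UNIV_I simp_thms)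
      also have "\<dots> \<longleftrightarrow> (x, y) \<in> box_edges J (cover_edges J) (cover_edges UNIV)"
        using True unfolding dle_cover_iff[OF conjunct1[OF True] conjunct2[OF True]]
          dle_cover_iff[OF conjunct2[OF True] conjunct1[OF True]]
        by (auto simp: xy box_edges_def cover_edges_def)
      finally show ?thesis .
    qed (auto simp: xy dle_edges_def box_edges_def)
  qed
  then show ?thesis by auto
qed

lemma oiso_dle_edges:
  fixes f :: "'a::order \<times> 'b::order \<Rightarrow> 'c::order \<times> 'd::order"
  assumes f: "oiso dle S dle T f" and xy: "(x, y) \<in> dle_edges S"
  shows "(f x, f y) \<in> dle_edges T"
proof -
  have T: "T = f ` S" using f by (auto simp: oiso_def bij_betw_def)
  have S: "x \<in> S" "y \<in> S" using xy by (auto simp: dle_edges_def)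
  show ?thesis using xy S unfolding T dle_edges_def
    by (simp add: oiso_le[OF f] oiso_eq[OF f] cong: ball_cong)
qed

section \<open>Decompositions read off from a layer\<close>

abbreviation component :: "'a::order \<Rightarrow> 'a set" where
  "component x \<equiv> {y. (x, y) \<in> conn}"

text \<open>A path in the layer over \<open>j\<close> is carried by \<open>f\<close> to a path in
  the other product, whose two projections are paths in the factors.\<close>

lemma layer_conn:
  fixes f :: "'a::order \<times> 'p::order \<Rightarrow> 'b::order \<times> 'q::order"
  assumes fin: "finite (UNIV :: 'p set)" and f: "oiso dle (J \<times> UNIV) dle (J' \<times> UNIV) f"
    and j: "j \<in> J" and p: "f (j, p0) = (j', q0)" "f (j, p) = (c, d)" "(p0, p) \<in> conn"
  shows "(j', c) \<in> (cover_edges J')\<^sup>*" "(q0, d) \<in> conn"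
proof -
  obtain n where "(p0, p) \<in> cover_edges UNIV ^^ n"
    using cover_edges_conn[OF fin p(3)] by (auto simp: rtrancl_power)
  then have "((j, p0), (j, p)) \<in> dle_edges (J \<times> UNIV) ^^ n"
    unfolding dle_edges_box by (rule box_relpow_snd[OF j])
  then have "(f (j, p0), f (j, p)) \<in> dle_edges (J' \<times> UNIV) ^^ n"
    by (rule relpow_map[rotated]) (rule oiso_dle_edges[OF f])
  then obtain k l where "(j', c) \<in> cover_edges J' ^^ k" "(q0, d) \<in> cover_edges UNIV ^^ l"
    unfolding dle_edges_box p by (blast dest: box_relpow_split)
  then show "(j', c) \<in> (cover_edges J')\<^sup>*" "(q0, d) \<in> conn"
    by (auto dest!: relpow_imp_rtrancl intro: cover_edges_imp_conn)
qed

text \<open>A decomposition K = X^op \<times> Z is written as an isomorphism from K with the reversed order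
  onto X \<times> Z with the order dle.\<close>
lemma layer_box:
  fixes f :: "'a::order \<times> 'p::order \<Rightarrow> 'b::order \<times> 'q::order"
  assumes fin: "finite (UNIV :: 'p set)" and f: "oiso dle (J \<times> UNIV) dle (J' \<times> UNIV) f"
    and j: "j \<in> J" and p0: "f (j, p0) = (j', q0)"
  defines "C \<equiv> {c. \<exists>p\<in>component p0. f (j, p) = (c, q0)}"
    and "D \<equiv> {d. \<exists>p\<in>component p0. f (j, p) = (j', d)}"
  shows "oiso (\<lambda>x y. y \<le> x) (component p0) dle (C \<times> D) (\<lambda>p. f (j, p))"
proof -
  define g where "g = inv_into (J \<times> UNIV) f"
  have b: "bij_betw f (J \<times> UNIV) (J' \<times> UNIV)" using f by (simp add: oiso_def)
  have g: "oiso dle (J' \<times> UNIV) dle (J \<times> UNIV) g" unfolding g_def by (rule oiso_inv[OF f])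
  have gf: "g (f x) = x" if "x \<in> J \<times> UNIV" for x
    unfolding g_def by (rule bij_betw_inv_into_left[OF b that])
  have fg: "f (g y) = y" if "y \<in> J' \<times> UNIV" for y
    unfolding g_def by (rule bij_betw_inv_into_right[OF b that])
  have J': "c \<in> J'" if "f (j, p) = (c, d)" for p c d
    using oiso_mem[OF f, of "(j, p)"] j that by simp
  \<comment> \<open>\<open>C\<close> and \<open>D\<close> are the traces of the image of the layer
    on the two lines through \<open>(j', q0)\<close>. Closure under corners makes the image the full
    box \<open>C \<times> D\<close>.\<close>
  have corner: "\<exists>p\<in>component p0. f (j, p) = (a, d)"
    if p12: "f (j, p1) = (a, b)" "f (j, p2) = (c, d)" "p1 \<in> component p0" "p2 \<in> component p0"
    for a b c d p1 p2
  proof -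
    have cn: "(p1, p2) \<in> (cover_edges UNIV)\<^sup>*"
      using p12(3,4) by (intro cover_edges_conn[OF fin]) (auto intro: conn_trans conn_sym)
    obtain p where p: "g (a, d) = (j, p)" "(p1, p) \<in> (cover_edges UNIV)\<^sup>*"
      by (rule layer_corner[OF cover_edges_subset cover_edges_subset
            oiso_dle_edges[OF f, unfolded dle_edges_box] oiso_dle_edges[OF g, unfolded dle_edges_box]
            gf j p12(1,2) J'[OF p12(1)] cn])
    have "f (j, p) = (a, d)" using fg[of "(a, d)"] p(1) J'[OF p12(1)] by simp
    moreover have "p \<in> component p0"
      using p12(3) cover_edges_imp_conn[OF p(2)] by (auto intro: conn_trans)
    ultimately show ?thesis by blast
  qed
  show ?thesis
  proof (rule oisoI)
    fix p assume p: "p \<in> component p0"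
    obtain c d where cd: "f (j, p) = (c, d)" by fastforce
    have "c \<in> C" unfolding C_def using corner[OF cd p0 p] by simp
    moreover have "d \<in> D" unfolding D_def using corner[OF p0 cd _ p] by simp
    ultimately show "f (j, p) \<in> C \<times> D" by (simp add: cd)
  next
    fix y assume "y \<in> C \<times> D"
    then obtain c d where "y = (c, d)" "c \<in> C" "d \<in> D" by auto
    then show "\<exists>p\<in>component p0. f (j, p) = y" using corner unfolding C_def D_def by blast
  next
    fix x y
    show "dle (f (j, x)) (f (j, y)) \<longleftrightarrow> y \<le> x"
      using oiso_le[OF f, of "(j, x)" "(j, y)"] j by (simp add: dle_def)
  qed auto
qed

text \<open>Two layers pass through the point \<open>(j', q)\<close>: the image of the layer over
  \<open>j\<close>, and the layer over \<open>j'\<close>. Each is a box by \<open>layer_box\<close>.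
  Their factors \<open>Z\<close> and \<open>W\<close> describe the intersection of the two layers,
  read in Q and in P, so they are isomorphic and \<open>Z\<close> can serve in both
  decompositions.\<close>

lemma layer_decomposition:
  fixes f :: "'a::order \<times> 'a \<Rightarrow> 'b::order \<times> 'b"
  assumes finP: "finite (UNIV :: 'a set)" and finQ: "finite (UNIV :: 'b set)"
    and P: "\<And>x y :: 'a. (x, y) \<in> conn"
    and f: "oiso dle (J \<times> UNIV) dle (J' \<times> UNIV) f" and j': "j' \<in> J'"
  obtains Y Z X \<phi> \<psi> j where
    "oiso (\<lambda>x y. y \<le> x) (UNIV :: 'a set) dle (Y \<times> Z) (\<phi> :: 'a \<Rightarrow> 'b \<times> 'b)"
    "oiso (\<lambda>x y. y \<le> x) (component q) dle (X \<times> Z) (\<psi> :: 'b \<Rightarrow> 'a \<times> 'b)"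
    "j \<in> J" "\<And>c. c \<in> Y \<Longrightarrow> (j', c) \<in> (cover_edges J')\<^sup>* \<and> (\<exists>p. f (j, p) = (c, q))"
proof -
  define g where "g = inv_into (J \<times> UNIV) f"
  have b: "bij_betw f (J \<times> UNIV) (J' \<times> UNIV)" using f by (simp add: oiso_def)
  have g: "oiso dle (J' \<times> UNIV) dle (J \<times> UNIV) g" unfolding g_def by (rule oiso_inv[OF f])
  have gf: "g (f x) = x" if "x \<in> J \<times> UNIV" for x
    unfolding g_def by (rule bij_betw_inv_into_left[OF b that])
  have fg: "f (g y) = y" if "y \<in> J' \<times> UNIV" for y
    unfolding g_def by (rule bij_betw_inv_into_right[OF b that])
  obtain j p0 where jp: "g (j', q) = (j, p0)" by fastforce
  have j: "j \<in> J" using oiso_mem[OF g, of "(j', q)"] j' by (simp add: jp)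
  have fj: "f (j, p0) = (j', q)" using fg[of "(j', q)"] j' jp by simp
  define Y where "Y = {c. \<exists>p\<in>component p0. f (j, p) = (c, q)}"
  define Z where "Z = {d. \<exists>p\<in>component p0. f (j, p) = (j', d)}"
  define X where "X = {b. \<exists>p\<in>component q. g (j', p) = (b, p0)}"
  define W where "W = {d. \<exists>p\<in>component q. g (j', p) = (j, d)}"
  have 1: "oiso (\<lambda>x y. y \<le> x) (component p0) dle (Y \<times> Z) (\<lambda>p. f (j, p))"
    unfolding Y_def Z_def by (rule layer_box[OF finP f j fj])
  have 2: "oiso (\<lambda>x y. y \<le> x) (component q) dle (X \<times> W) (\<lambda>p. g (j', p))"
    unfolding X_def W_def by (rule layer_box[OF finQ g j' jp])
  have W: "f (j, d) = (j', snd (f (j, d))) \<and> snd (f (j, d)) \<in> Z" if "d \<in> W" for d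
  proof -
    from that obtain p where p: "p \<in> component q" "g (j', p) = (j, d)" by (auto simp: W_def)
    then have "f (j, d) = (j', p)" using fg[of "(j', p)"] j' by simp
    then show ?thesis using P by (auto simp: Z_def)
  qed
  have 3: "oiso dle (X \<times> W) dle (X \<times> Z) (\<lambda>x. (fst x, snd (f (j, snd x))))"
  proof (rule oisoI)
    fix y assume "y \<in> X \<times> Z"
    then obtain x z where y: "y = (x, z)" "x \<in> X" "z \<in> Z" by auto
    then obtain p where p: "f (j, p) = (j', z)" by (auto simp: Z_def)
    then have "g (j', z) = (j, p)" using gf[of "(j, p)"] j by simp
    moreover have "z \<in> component q" using layer_conn(2)[OF finP f j fj p P] by simp
    ultimately have "p \<in> W" by (auto simp: W_def)
    then show "\<exists>x\<in>X \<times> W. (fst x, snd (f (j, snd x))) = y" using y p by (intro bexI[of _ "(x, p)"]) auto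
  next
    fix x y assume "x \<in> X \<times> W" "y \<in> X \<times> W"
    then have "snd x \<in> W" "snd y \<in> W" by auto
    have "snd (f (j, snd y)) \<le> snd (f (j, snd x)) \<longleftrightarrow> dle (f (j, snd x)) (f (j, snd y))"
      using W[OF \<open>snd x \<in> W\<close>] W[OF \<open>snd y \<in> W\<close>] by (metis dle_def fst_conv order_refl)
    also have "\<dots> \<longleftrightarrow> snd y \<le> snd x" using oiso_le[OF f] j by (simp add: dle_def)
    finally show "dle (fst x, snd (f (j, snd x))) (fst y, snd (f (j, snd y))) \<longleftrightarrow> dle x y"
      by (simp add: dle_def)
  qed (use W in \<open>auto dest: dle_antisym\<close>)
  have "component p0 = UNIV" using P by auto
  note layer = 1[unfolded this]
  show ?thesis
  proof (rule that[OF layer oiso_comp[OF 2 3] j])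
    fix c assume "c \<in> Y"
    then obtain p where "f (j, p) = (c, q)" by (auto simp: Y_def)
    then show "(j', c) \<in> (cover_edges J')\<^sup>* \<and> (\<exists>p. f (j, p) = (c, q))"
      using layer_conn(1)[OF finP f j fj _ P] by blast
  qed
qed

section \<open>Central elements and chains from the bottom to them\<close>

lemma ltr_relpow_between:
  assumes "(x, y) \<in> ltr A ^^ n" and "\<And>z. z \<in> A \<Longrightarrow> x \<le> z \<Longrightarrow> z \<le> y \<Longrightarrow> z \<in> B"
  shows "(x, y) \<in> ltr B ^^ n"
  using assms
proof (induction n arbitrary: y)
  case (Suc n)
  then obtain z where z: "(x, z) \<in> ltr A ^^ n" "z \<in> A" "y \<in> A" "z < y" by (auto simp: ltr_def)
  have "(x, z) \<in> ltr B ^^ n"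
    using Suc.prems(2) z(4) by (intro Suc.IH[OF z(1)]) (auto intro: order_trans)
  moreover have "(z, y) \<in> ltr B"
    using Suc.prems(2)[of z] Suc.prems(2)[of y] ltr_relpow_le[OF z(1)] z
    by (auto simp: ltr_def intro: order_trans)
  ultimately show ?case by auto
qed simp

text \<open>An atom of the interval below \<open>t\<close> will do, since only \<open>v\<close> lies
  strictly below it.\<close>

lemma JI_below:
  fixes v :: "'b::order"
  assumes fin: "finite (UNIV :: 'b set)" and "v < t" "t \<le> w"
  obtains j where "j \<in> JI {v..w}" "j \<le> t"
proof -
  have "finite {x. v < x \<and> x \<le> t}" by (rule finite_subset[OF subset_UNIV fin])
  moreover have "t \<in> {x. v < x \<and> x \<le> t}" using assms by simp
  ultimately obtain j where j: "j \<in> {x. v < x \<and> x \<le> t}"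
    "\<And>x. x \<in> {x. v < x \<and> x \<le> t} \<Longrightarrow> x \<le> j \<Longrightarrow> j = x"
    using finite_has_minimal[of "{x. v < x \<and> x \<le> t}"] by blast
  have "j \<in> JI {v..w}"
    unfolding JI_def
  proof (intro CollectI conjI bexI[of _ v] ballI impI)
    fix z assume z: "z \<in> {v..w}" "z < j"
    then have "z \<le> t" using j(1) by (auto intro: order_trans dest: less_imp_le)
    then show "z \<le> v" using j(2)[of z] z by (auto simp: le_less)
  qed (use j assms in \<open>auto intro: order_trans dest: less_imp_le\<close>)
  then show ?thesis using j(1) that by blast
qed

text \<open>The top of a nontrivial direct factor of the interval is central: an element of JI lies below
  exactly one of the tops of two complementary factors, and comparable ones lie below the same top.\<close>
definition central :: "'b::order \<Rightarrow> 'b \<Rightarrow> 'b \<Rightarrow> bool" where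
  "central v w t \<longleftrightarrow> t \<in> {v..w} \<and>
     (\<exists>j\<in>JI {v..w}. \<forall>c. (j, c) \<in> (cover_edges (JI {v..w}))\<^sup>* \<longrightarrow> c \<le> t)"

text \<open>The witness takes Z of maximal size, so that no other decomposition has a smaller Y.\<close>
lemma decomposition_central:
  fixes h :: "('a::order \<Rightarrow> 'a) \<Rightarrow> ('b::order \<Rightarrow> 'b)"
  assumes finP: "finite (UNIV :: 'a set)" and finQ: "finite (UNIV :: 'b set)"
    and P: "\<And>x y :: 'a. (x, y) \<in> conn"
    and h: "oisole (ivl_maps u u') (ivl_maps v v') h" and u: "u \<le> u'" and v: "v < v'"
  obtains Y Z X \<phi> \<psi> where
    "oiso (\<lambda>x y. y \<le> x) (UNIV :: 'a set) dle (Y \<times> Z) (\<phi> :: 'a \<Rightarrow> 'b \<times> 'b)"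
    "oiso (\<lambda>x y. y \<le> x) (component q) dle (X \<times> Z) (\<psi> :: 'b \<Rightarrow> 'a \<times> 'b)"
    "\<And>t. central v v' t \<Longrightarrow> \<exists>N\<ge>card Y. (v, t) \<in> ltr UNIV ^^ N"
proof -
  \<comment> \<open>\<open>f\<close> is \<open>h\<close> on step functions, written in their
    parameters.\<close>
  define f where "f = inv_into (JI {v..v'} \<times> UNIV) (step v) \<circ> (h \<circ> step u)"
  have f: "oiso dle (JI {u..u'} \<times> UNIV) dle (JI {v..v'} \<times> UNIV) f"
    unfolding f_def
    by (rule oiso_comp[OF oiso_comp[OF step_oiso oisole_JI_restrict[OF h]] oiso_inv[OF step_oiso]])
  have hf: "h (step u (j, p)) = step v (c, d)" if "j \<in> JI {u..u'}" "f (j, p) = (c, d)" for j p c d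
  proof -
    have "h (step u (j, p)) \<in> JI (ivl_maps v v')"
      using that(1) oiso_mem[OF oisole_JI_restrict[OF h] step_JI] by simp
    then have "step v (inv_into (JI {v..v'} \<times> UNIV) (step v) (h (step u (j, p)))) = h (step u (j, p))"
      using step_oiso[of v v'] by (intro f_inv_into_f) (auto simp: oiso_def bij_betw_def)
    then show ?thesis using that(2) by (simp add: f_def)
  qed
  define dec where "dec Y Z X \<phi> \<psi> \<longleftrightarrow>
     oiso (\<lambda>x y. y \<le> x) (UNIV :: 'a set) dle (Y \<times> Z) \<phi> \<and>
     oiso (\<lambda>x y. y \<le> x) (component q) dle (X \<times> Z) \<psi>"
    for Y Z :: "'b set" and X :: "'a set" and \<phi> :: "'a \<Rightarrow> 'b \<times> 'b" and \<psi> :: "'b \<Rightarrow> 'a \<times> 'b"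
  define D where "D k \<longleftrightarrow> (\<exists>Y Z X \<phi> \<psi>. dec Y Z X \<phi> \<psi> \<and> card Z = k)" for k
  obtain j where "j \<in> JI {v..v'}" using JI_below[OF finQ v order_refl] by blast
  from layer_decomposition[OF finP finQ P f this, of q] have D: "\<exists>k. D k"
    unfolding D_def dec_def by metis
  have bound: "D k \<Longrightarrow> k \<le> card (UNIV :: 'b set)" for k
    unfolding D_def using card_mono[OF finQ subset_UNIV] by blast
  define k where "k = Greatest D"
  have "D k" unfolding k_def using D bound by (metis GreatestI_nat)
  have max: "l \<le> k" if "D l" for l unfolding k_def using that bound by (metis Greatest_le_nat)
  obtain Y Z X \<phi> \<psi> where YZ: "dec Y Z X \<phi> \<psi>" "card Z = k" using \<open>D k\<close> unfolding D_def by blast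
  show ?thesis
  proof (rule that)
    show "oiso (\<lambda>x y. y \<le> x) (UNIV :: 'a set) dle (Y \<times> Z) \<phi>"
      "oiso (\<lambda>x y. y \<le> x) (component q) dle (X \<times> Z) \<psi>" using YZ by (auto simp: dec_def)
  next
    fix t assume "central v v' t"
    then obtain j' where t: "t \<in> {v..v'}" and j': "j' \<in> JI {v..v'}"
      and t_max: "\<And>c. (j', c) \<in> (cover_edges (JI {v..v'}))\<^sup>* \<Longrightarrow> c \<le> t"
      by (auto simp: central_def)
    \<comment> \<open>With \<open>q0\<close> maximal, a map between the constant \<open>v\<close>
      and \<open>step v (t, q0)\<close> differs from \<open>v\<close> at most at \<open>q0\<close>.
      Chains of such maps are therefore chains of values at \<open>q0\<close>.\<close>
    obtain q0 where q0: "q0 \<in> component q" "\<And>x. x \<in> component q \<Longrightarrow> \<not> q0 < x"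
      using finite_has_maximal_elem[of "component q"] finite_subset[OF subset_UNIV finQ] conn_refl
      by (metis empty_iff mem_Collect_eq)
    have top: "x = q0" if "q0 \<le> x" for x
      using q0 that conn_trans[OF _ conn_le[OF that], of q] by (auto simp: le_less)
    have comp: "component q0 = component q" using q0(1) by (auto intro: conn_trans conn_sym)
    obtain Y' Z' X' \<phi>' \<psi>' i where
      1: "oiso (\<lambda>x y. y \<le> x) (UNIV :: 'a set) dle (Y' \<times> Z') (\<phi>' :: 'a \<Rightarrow> 'b \<times> 'b)" and
      2: "oiso (\<lambda>x y. y \<le> x) (component q0) dle (X' \<times> Z') (\<psi>' :: 'b \<Rightarrow> 'a \<times> 'b)" and
      i: "i \<in> JI {u..u'}" and
      Y': "\<And>c. c \<in> Y' \<Longrightarrow> (j', c) \<in> (cover_edges (JI {v..v'}))\<^sup>* \<and> (\<exists>p. f (i, p) = (c, q0))"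
      using layer_decomposition[OF finP finQ P f j', of q0] by metis
    have "card Z' \<le> card Z"
      using max[of "card Z'"] 1 2 YZ(2) unfolding D_def dec_def comp by metis
    moreover have "card Y' * card Z' = card Y * card Z"
      using oiso_card[OF 1] YZ(1) by (auto simp: card_cartesian_product dec_def dest: oiso_card)
    moreover have "card Y * card Z > 0"
      using YZ(1) finP by (auto simp: dec_def card_cartesian_product dest!: oiso_card
          intro!: gr0I)
    \<comment> \<open>Both products equal |P|, so the largest \<open>Z\<close> goes with the
      smallest \<open>Y\<close>.\<close>
    ultimately have Y_le: "card Y \<le> card Y'"
    proof (intro leI notI)
      assume "card Y' < card Y" and le: "card Z' \<le> card Z" and eq: "card Y' * card Z' = card Y * card Z"
        and pos: "0 < card Y * card Z"
      then have "card Y' * card Z < card Y * card Z" by simp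
      with mult_le_mono2[OF le, of "card Y'"] eq show False by simp
    qed
    \<comment> \<open>\<open>T\<close> is the constant \<open>v\<close> raised to \<open>t\<close>
      at \<open>q0\<close>. By centrality it lies above every \<open>step v (c, q0)\<close> with
      \<open>c \<in> Y'\<close>, so its preimage \<open>g\<close> exceeds \<open>u\<close> at
      \<open>card Y'\<close> distinct points and is reached from the constant \<open>u\<close> in at
      least that many steps.\<close>
    define T where "T = step v (t, q0)"
    have T: "T \<in> ivl_maps v v'" unfolding T_def using t by (intro step_ivl) simp
    obtain g where g: "g \<in> ivl_maps u u'" "h g = T" using oiso_surj[OF h T] by blast
    obtain p where p: "\<And>c. c \<in> Y' \<Longrightarrow> f (i, p c) = (c, q0)" using Y' by metis
    have i_gt: "u < i" using JI_ivl_gt[OF i] .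
    have supp: "u < g (p c)" if c: "c \<in> Y'" for c
    proof -
      have "h (step u (i, p c)) \<le> h g"
        using t_max Y'[OF c] t unfolding hf[OF i p[OF c]] g(2) T_def
        by (auto simp: le_fun_def step_def)
      moreover have "step u (i, p c) \<in> ivl_maps u u'"
        using i by (intro step_ivl) (simp add: JI_def)
      ultimately have "step u (i, p c) \<le> g" using oiso_le[OF h] g(1) by blast
      then have "step u (i, p c) (p c) \<le> g (p c)" by (rule le_funD)
      then show ?thesis using i_gt by (simp add: step_def)
    qed
    have "inj_on p Y'" using p by (metis inj_onI prod.inject)
    moreover have "p ` Y' \<subseteq> {x. u \<noteq> g x}" using supp by auto
    ultimately have card_supp: "card Y' \<le> card {x. u \<noteq> g x}"
      by (meson card_inj_on_le finP finite_subset subset_UNIV)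
    define N where "N = card {x. u \<noteq> g x}"
    have ivl: "f \<in> ivl_maps a b" if "mono f" "(\<lambda>_. a) \<le> f" "f \<le> g" "g \<in> ivl_maps a b"
      for a b :: "'c::order" and f g
      using that by (auto simp: ivl_maps_def le_fun_def intro: order_trans)
    have cu: "(\<lambda>_. u) \<in> ivl_maps u u'" and cv: "(\<lambda>_. v) \<in> ivl_maps v v'"
      using u v by (auto simp: ivl_maps_def)
    have "((\<lambda>_. u), g) \<in> ltr opm ^^ N"
      unfolding N_def using g(1) by (intro maps_chain[OF finP]) (auto simp: ivl_maps_def le_fun_def)
    then have "((\<lambda>_. u), g) \<in> ltr (ivl_maps u u') ^^ N"
      by (rule ltr_relpow_between) (use g(1) in \<open>auto intro: ivl\<close>)
    then have "(h (\<lambda>_. u), T) \<in> ltr (ivl_maps v v') ^^ N"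
      using oisole_ltr_relpow[OF h] g(2) by blast
    moreover have "h (\<lambda>_. u) = (\<lambda>_. v)"
    proof (rule antisym)
      show "(\<lambda>_. v) \<le> h (\<lambda>_. u)" using oiso_mem[OF h cu] by (auto simp: ivl_maps_def le_fun_def)
      obtain x where x: "x \<in> ivl_maps u u'" "h x = (\<lambda>_. v)" using oiso_surj[OF h cv] by blast
      then have "(\<lambda>_. u) \<le> x" by (auto simp: ivl_maps_def le_fun_def)
      then show "h (\<lambda>_. u) \<le> (\<lambda>_. v)" using oiso_le[OF h cu x(1)] x(2) by simp
    qed
    ultimately have "((\<lambda>_. v), T) \<in> ltr (ivl_maps v v') ^^ N" by simp
    then have "((\<lambda>_. v), T) \<in> ltr {f \<in> ivl_maps v v'. f \<le> T} ^^ N"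
      by (rule ltr_relpow_between) auto
    then have "((\<lambda>_. v) q0, T q0) \<in> ltr UNIV ^^ N"
    proof (rule relpow_map[rotated])
      fix x y assume xy: "(x, y) \<in> ltr {f \<in> ivl_maps v v'. f \<le> T}"
      then have le: "x a \<le> y a" "y a \<le> T a" "v \<le> x a" "v \<le> y a" for a
        by (auto simp: ltr_def less_fun_def le_fun_def ivl_maps_def)
      obtain a where a: "\<not> y a \<le> x a" using xy by (auto simp: ltr_def less_fun_def le_fun_def)
      then have "a = q0" using le[of a] top[of a] by (auto simp: T_def step_def split: if_splits)
      then show "(x q0, y q0) \<in> ltr UNIV" using a le(1)[of q0] by (auto simp: ltr_def less_le)
    qed
    then have "(v, t) \<in> ltr UNIV ^^ N" by (simp add: T_def step_def)
    then show "\<exists>N\<ge>card Y. (v, t) \<in> ltr UNIV ^^ N"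
      using Y_le card_supp N_def by (intro exI[of _ N]) simp
  qed
qed

text \<open>\<open>\<chi>\<close> makes \<open>{v..w}\<close> a product of an interval of
  \<open>Y\<close>, reversed, and an interval of \<open>Z\<close>. The witness \<open>t\<close> is
  the top of the first factor: its first coordinate is that of \<open>w\<close>, its second that of
  \<open>v\<close>. A chain from \<open>v\<close> to \<open>t\<close> moves only in
  \<open>Y\<close>.\<close>

lemma central_factor:
  fixes \<chi> :: "'b::order \<Rightarrow> 'y::order \<times> 'z::order"
  assumes fin: "finite (UNIV :: 'b set)" and v: "v \<le> w"
    and mem: "\<And>x. x \<in> {v..w} \<Longrightarrow> \<chi> x \<in> Y \<times> Z"
    and le: "\<And>x y. x \<in> {v..w} \<Longrightarrow> y \<in> {v..w} \<Longrightarrow> dle (\<chi> y) (\<chi> x) \<longleftrightarrow> x \<le> y"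
    and surj: "\<And>a. a \<in> Y \<times> Z \<Longrightarrow> dle (\<chi> w) a \<Longrightarrow> dle a (\<chi> v) \<Longrightarrow> \<exists>x\<in>{v..w}. \<chi> x = a"
    and Y: "has_length Y l" and ne: "fst (\<chi> v) \<noteq> fst (\<chi> w)"
  shows "\<exists>t. central v w t \<and> (\<forall>N. (v, t) \<in> ltr UNIV ^^ N \<longrightarrow> N \<le> l)"
proof -
  obtain y0 z0 y1 z1 where vw: "\<chi> v = (y0, z0)" "\<chi> w = (y1, z1)" by fastforce
  have YZ: "y0 \<in> Y" "y1 \<in> Y" "z0 \<in> Z" "z1 \<in> Z" "y1 \<le> y0" "z0 \<le> z1" "y1 \<noteq> y0"
    using mem[of v] mem[of w] le[of v w] v ne by (auto simp: vw dle_def)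
  have surj': "\<exists>x\<in>{v..w}. \<chi> x = (y, z)" if "y \<in> Y" "z \<in> Z" "y1 \<le> y" "y \<le> y0" "z0 \<le> z" "z \<le> z1" for y z
    using that by (intro surj) (auto simp: vw dle_def)
  have in_range: "y1 \<le> y \<and> y \<le> y0 \<and> z0 \<le> z \<and> z \<le> z1 \<and> y \<in> Y \<and> z \<in> Z"
    if "x \<in> {v..w}" "\<chi> x = (y, z)" for x y z
    using that le[of v x] le[of x w] v mem[of x] by (auto simp: vw dle_def)
  obtain t where t: "t \<in> {v..w}" "\<chi> t = (y1, z0)" using surj'[of y1 z0] YZ by auto
  obtain s where s: "s \<in> {v..w}" "\<chi> s = (y0, z1)" using surj'[of y0 z1] YZ by auto
  \<comment> \<open>If both projections \<open>a\<close> and \<open>b\<close> of \<open>j\<close>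
    were strictly below \<open>j\<close>, they would lie below \<open>d\<close>, and comparing
    coordinates would put \<open>j\<close> below \<open>d\<close> too.\<close>
  have split: "j \<le> t \<or> j \<le> s" if jJ: "j \<in> JI {v..w}" for j
  proof -
    obtain d where d: "j \<in> {v..w}" "d \<in> {v..w}" "d < j" "\<And>x. x \<in> {v..w} \<Longrightarrow> x < j \<Longrightarrow> x \<le> d"
      using jJ unfolding JI_def by (elim CollectE conjE bexE) blast
    obtain y z where j: "\<chi> j = (y, z)" by fastforce
    note r = in_range[OF d(1) j]
    obtain a where a: "a \<in> {v..w}" "\<chi> a = (y, z0)" using surj'[of y z0] r YZ by auto
    obtain b where b: "b \<in> {v..w}" "\<chi> b = (y0, z)" using surj'[of y0 z] r YZ by auto
    have ab: "a \<le> j" "b \<le> j" using le[OF a(1) d(1)] le[OF b(1) d(1)] a b j r by (auto simp: dle_def)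
    consider "a = j" | "b = j" | "a < j" "b < j" using ab by (auto simp: le_less)
    then show ?thesis
    proof cases
      case 1
      then show ?thesis using le[OF d(1) t(1)] t j a r by (auto simp: dle_def)
    next
      case 2
      then show ?thesis using le[OF d(1) s(1)] s j b r by (auto simp: dle_def)
    next
      case 3
      then have "a \<le> d" "b \<le> d" using d(4) a b by auto
      then have "dle (\<chi> d) (\<chi> j)" using le[OF a(1) d(2)] le[OF b(1) d(2)] a b j by (auto simp: dle_def)
      then show ?thesis using le[OF d(1,2)] d(3) by auto
    qed
  qed
  have meet: "\<not> (j \<le> t \<and> j \<le> s)" if "j \<in> JI {v..w}" for j
  proof
    assume "j \<le> t \<and> j \<le> s"
    moreover have j: "j \<in> {v..w}" using that by (auto simp: JI_def)
    ultimately have "dle (\<chi> v) (\<chi> j)" using le[OF j t(1)] le[OF j s(1)] t s by (auto simp: dle_def vw)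
    then have "j \<le> v" using le[OF j, of v] v by simp
    then show False using JI_ivl_gt[OF that] by simp
  qed
  have "v \<noteq> t" using t(2) vw(1) YZ by auto
  then have "v < t" using t(1) by (simp add: less_le)
  then obtain j where j: "j \<in> JI {v..w}" "j \<le> t" using JI_below[OF fin, of v t w] t by auto
  have "c \<le> t" if "(j, c) \<in> (cover_edges (JI {v..w}))\<^sup>*" for c
    using that
  proof (induction rule: rtrancl_induct)
    case (step a b)
    then have ab: "a \<in> JI {v..w}" "b \<in> JI {v..w}" "a \<le> b \<or> b \<le> a" by (auto simp: cover_edges_def)
    show ?case using split[OF ab(2)] meet[OF ab(1)] ab(3) step.IH by (blast intro: order_trans)
  qed (rule j(2))
  then have c: "central v w t" using t j(1) by (auto simp: central_def)
  have chain: "(fst (\<chi> x), y0) \<in> ltr Y ^^ N" if "(v, x) \<in> ltr UNIV ^^ N" "x \<le> t" for x N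
    using that
  proof (induction N arbitrary: x)
    case 0
    then have "x = v" by simp
    then show ?case using vw(1) by simp
  next
    case (Suc N)
    then obtain z where z: "(v, z) \<in> ltr UNIV ^^ N" "z < x" by (auto simp: ltr_def)
    have zx: "z \<in> {v..w}" "x \<in> {v..w}" "z \<le> t"
      using ltr_relpow_le[OF z(1)] z(2) t(1) Suc.prems(2) by (auto intro: order_trans dest: less_imp_le)
    have "snd (\<chi> z) = z0" "snd (\<chi> x) = z0"
      using zx le[OF zx(1) t(1)] le[OF zx(2) t(1)] t Suc.prems(2) in_range[OF zx(1), of "fst (\<chi> z)" "snd (\<chi> z)"]
        in_range[OF zx(2), of "fst (\<chi> x)" "snd (\<chi> x)"] by (auto simp: dle_def)
    moreover have "dle (\<chi> x) (\<chi> z)" "\<not> dle (\<chi> z) (\<chi> x)"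
      unfolding le[OF zx(1,2)] le[OF zx(2,1)] using z(2) by auto
    ultimately have "fst (\<chi> x) < fst (\<chi> z)"
      unfolding dle_def by (simp add: less_le_not_le)
    then have "(fst (\<chi> x), fst (\<chi> z)) \<in> ltr Y" using mem[OF zx(1)] mem[OF zx(2)] by (auto simp: ltr_def)
    then show ?case using relpow_Suc_I2 Suc.IH[OF z(1) zx(3)] by metis
  qed
  have "N \<le> l" if "(v, t) \<in> ltr UNIV ^^ N" for N
    using chain[OF that order_refl] has_length_le[OF Y, of y1] YZ by (simp add: t)
  with c show ?thesis by blast
qed

section \<open>Lengths of the factors\<close>

lemma oiso_geD:
  assumes "oiso (\<lambda>x y. y \<le> x) K dle (X \<times> Z) \<psi>" "p \<in> K" "q \<in> K"
  shows "p \<le> q \<longleftrightarrow> fst (\<psi> q) \<le> fst (\<psi> p) \<and> snd (\<psi> p) \<le> snd (\<psi> q)"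
  using oiso_le[OF assms(1,3,2)] by (simp add: dle_def)

text \<open>Climb first through \<open>X\<close>, along its chain read backwards because
  \<open>X\<close> is reversed, and then through \<open>Z\<close>.\<close>

lemma product_chain:
  assumes \<psi>: "oiso (\<lambda>x y. y \<le> x) K dle (X \<times> Z) \<psi>"
    and X: "has_length X a" and Z: "has_length Z b"
  obtains p q where "p \<in> K" "(p, q) \<in> ltr K ^^ (a + b)"
proof -
  obtain x1 x2 where x: "x1 \<in> X" "(x1, x2) \<in> ltr X ^^ a" using X by (auto simp: has_length_def)
  obtain z1 z2 where z: "z1 \<in> Z" "(z1, z2) \<in> ltr Z ^^ b" using Z by (auto simp: has_length_def)
  define k where "k = inv_into K \<psi>"
  have k: "oiso dle (X \<times> Z) (\<lambda>x y. y \<le> x) K k" unfolding k_def by (rule oiso_inv[OF \<psi>])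
  have k_less: "(k s, k t) \<in> ltr K" if "s \<in> X \<times> Z" "t \<in> X \<times> Z" "dle t s" "s \<noteq> t" for s t
    using that oiso_le[OF k that(2,1)] oiso_eq[OF k that(1,2)] oiso_mem[OF k]
    by (auto simp: ltr_def less_le)
  have x2: "x2 \<in> X" using ltr_relpow_closed x by blast
  have 1: "(k (x1, z1), k (x1, z2)) \<in> ltr K ^^ b"
    using z(2)
  proof (rule relpow_map[rotated])
    show "(k (x1, u), k (x1, w)) \<in> ltr K" if "(u, w) \<in> ltr Z" for u w
      using that x(1) by (intro k_less) (auto simp: ltr_def dle_def)
  qed
  have "(k (y, z1), k (x1, z1)) \<in> ltr K ^^ n" if "(x1, y) \<in> ltr X ^^ n" for n y
    using that
  proof (induction n arbitrary: y)
    case (Suc n)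
    then obtain w where w: "(x1, w) \<in> ltr X ^^ n" "(w, y) \<in> ltr X" by auto
    have "(k (y, z1), k (w, z1)) \<in> ltr K"
      using w(2) z(1) by (intro k_less) (auto simp: ltr_def dle_def)
    then show ?case using Suc.IH[OF w(1)] relpow_Suc_I2 by metis
  qed simp
  from relpow_trans[OF this[OF x(2)] 1] show ?thesis
    using oiso_mem[OF k, of "(x2, z1)"] x2 z(1) that by simp
qed

text \<open>Every step moves at least one coordinate strictly. It may move both, so the lengths of
  the projected chains only bound \<open>N\<close> from above.\<close>

lemma product_chain_bound:
  assumes \<phi>: "oiso (\<lambda>x y. y \<le> x) K dle (X \<times> Z) \<phi>"
    and X: "has_length X a" and Z: "has_length Z b" and "p \<in> K" and ch: "(p, q) \<in> ltr K ^^ N"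
  shows "N \<le> a + b"
proof -
  have "\<exists>k l. N \<le> k + l \<and> (fst (\<phi> q), fst (\<phi> p)) \<in> ltr X ^^ k \<and> (snd (\<phi> p), snd (\<phi> q)) \<in> ltr Z ^^ l"
    using ch
  proof (induction N arbitrary: q)
    case 0
    then show ?case by (intro exI[of _ 0]) simp
  next
    case (Suc N)
    then obtain r where r: "(p, r) \<in> ltr K ^^ N" "r \<in> K" "q \<in> K" "r < q" by (auto simp: ltr_def)
    from Suc.IH[OF r(1)] obtain k l where kl: "N \<le> k + l"
      "(fst (\<phi> r), fst (\<phi> p)) \<in> ltr X ^^ k" "(snd (\<phi> p), snd (\<phi> r)) \<in> ltr Z ^^ l" by blast
    have le: "fst (\<phi> q) \<le> fst (\<phi> r)" "snd (\<phi> r) \<le> snd (\<phi> q)"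
      using oiso_geD[OF \<phi> r(2,3)] r(4) by (auto dest: less_imp_le)
    have m: "\<phi> r \<in> X \<times> Z" "\<phi> q \<in> X \<times> Z" using oiso_mem[OF \<phi>] r by auto
    have "\<phi> r \<noteq> \<phi> q" using oiso_eq[OF \<phi> r(2,3)] r(4) by simp
    then consider "fst (\<phi> q) < fst (\<phi> r)" | "fst (\<phi> q) = fst (\<phi> r)" "snd (\<phi> r) < snd (\<phi> q)"
      using le by (auto simp: less_le prod_eq_iff)
    then show ?case
    proof cases
      case 1
      then have "(fst (\<phi> q), fst (\<phi> p)) \<in> ltr X ^^ Suc k"
        using kl(2) m by (intro relpow_Suc_I2) (auto simp: ltr_def)
      moreover obtain l' where "l' \<ge> l" "(snd (\<phi> p), snd (\<phi> q)) \<in> ltr Z ^^ l'"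
      proof -
        have "\<exists>l'\<ge>l. (snd (\<phi> p), snd (\<phi> q)) \<in> ltr Z ^^ l'"
        proof (cases "snd (\<phi> r) = snd (\<phi> q)")
          case True
          then show ?thesis using kl(3) by auto
        next
          case False
          then have "(snd (\<phi> r), snd (\<phi> q)) \<in> ltr Z" using m le by (auto simp: ltr_def less_le)
          then have "(snd (\<phi> p), snd (\<phi> q)) \<in> ltr Z ^^ Suc l" using kl(3) by auto
          then show ?thesis by (intro exI[of _ "Suc l"]) simp
        qed
        then show ?thesis using that by blast
      qed
      ultimately show ?thesis using kl(1) by (intro exI[of _ "Suc k"] exI[of _ l']) simp
    next
      case 2
      then have "(snd (\<phi> p), snd (\<phi> q)) \<in> ltr Z ^^ Suc l" using kl(3) m by (auto simp: ltr_def)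
      then show ?thesis using kl(1,2) 2(1) by (intro exI[of _ k] exI[of _ "Suc l"]) simp
    qed
  qed
  then obtain k l where kl: "N \<le> k + l" "(fst (\<phi> q), fst (\<phi> p)) \<in> ltr X ^^ k"
    "(snd (\<phi> p), snd (\<phi> q)) \<in> ltr Z ^^ l" by blast
  have "q \<in> K" using ltr_relpow_closed[OF ch \<open>p \<in> K\<close>] .
  then have "\<phi> p \<in> X \<times> Z" "\<phi> q \<in> X \<times> Z" using oiso_mem[OF \<phi>] \<open>p \<in> K\<close> by auto
  then have "k \<le> a" "l \<le> b"
    using has_length_le[OF X _ kl(2)] has_length_le[OF Z _ kl(3)] by (auto simp: mem_Times_iff)
  then show ?thesis using kl(1) by simp
qed

text \<open>First coordinates that agree at the ends agree on the whole interval, so the chain moves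
  in the second coordinate only.\<close>

lemma snd_chain:
  fixes \<chi> :: "'b::order \<Rightarrow> 'y::order \<times> 'z::order"
  assumes le: "\<And>x y. x \<in> {v..w} \<Longrightarrow> y \<in> {v..w} \<Longrightarrow> dle (\<chi> y) (\<chi> x) \<longleftrightarrow> x \<le> y"
    and mem: "\<And>x. x \<in> {v..w} \<Longrightarrow> \<chi> x \<in> Y \<times> Z"
    and eq: "fst (\<chi> v) = fst (\<chi> w)" and ch: "(v, w) \<in> ltr UNIV ^^ n"
  shows "(snd (\<chi> v), snd (\<chi> w)) \<in> ltr Z ^^ n"
proof -
  have "v \<le> w" by (rule ltr_relpow_le[OF ch])
  have "(v, w) \<in> ltr {v..w} ^^ n" by (rule ltr_relpow_between[OF ch]) auto
  then show ?thesis
  proof (rule relpow_map[rotated])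
    fix x y assume "(x, y) \<in> ltr {v..w}"
    then have xy: "x \<in> {v..w}" "y \<in> {v..w}" "x < y" by (auto simp: ltr_def)
    have "fst (\<chi> z) = fst (\<chi> v)" if "z \<in> {v..w}" for z
      using le[of v z] le[of z w] that \<open>v \<le> w\<close> eq by (auto simp: dle_def intro: antisym)
    then have "fst (\<chi> x) = fst (\<chi> y)" using xy by simp
    moreover have "dle (\<chi> y) (\<chi> x)" "\<not> dle (\<chi> x) (\<chi> y)"
      unfolding le[OF xy(1,2)] le[OF xy(2,1)] using xy(3) by auto
    ultimately have "snd (\<chi> x) < snd (\<chi> y)"
      unfolding dle_def by (simp add: less_le_not_le)
    then show "(snd (\<chi> x), snd (\<chi> y)) \<in> ltr Z"
      using mem[OF xy(1)] mem[OF xy(2)] by (auto simp: ltr_def)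
  qed
qed

text \<open>The constants on the chain refine to a chain of m|Q| = n|P| steps in Q^Q. Its image has
  maximal length in P^P.\<close>

lemma longest_chain_ends_const:
  fixes H :: "('b::order \<Rightarrow> 'b) \<Rightarrow> ('a::order \<Rightarrow> 'a)"
  assumes finP: "finite (UNIV :: 'a set)" and finQ: "finite (UNIV :: 'b set)"
    and P: "poset_connected (UNIV :: 'a set)" and H: "oisole opm opm H"
    and n: "has_length (UNIV :: 'a set) n"
    and nm: "n * card (UNIV :: 'a set) = m * card (UNIV :: 'b set)"
    and ch: "(v, w) \<in> ltr UNIV ^^ m"
  obtains u u' where "H (\<lambda>_. v) = (\<lambda>_. u)" "H (\<lambda>_. w) = (\<lambda>_. u')"
proof -
  have "(H (\<lambda>_. v), H (\<lambda>_. w)) \<in> ltr opm ^^ (n * card (UNIV :: 'a set))"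
    unfolding nm by (rule oisole_ltr_relpow[OF H const_maps_chain[OF finQ ch]])
  moreover have "mono (H (\<lambda>_. v))" "mono (H (\<lambda>_. w))"
    using oiso_mem[OF H, of "\<lambda>_. v"] oiso_mem[OF H, of "\<lambda>_. w"] by auto
  ultimately show ?thesis using longest_maps_chain_const[OF finP n P] that by metis
qed

section \<open>Comparison of P and Q when P has positive length\<close>

theorem connected_iso_of_length_pos:
  fixes H :: "('b::order \<Rightarrow> 'b) \<Rightarrow> ('a::order \<Rightarrow> 'a)"
  assumes finP: "finite (UNIV :: 'a set)" and finQ: "finite (UNIV :: 'b set)"
    and P: "poset_connected (UNIV :: 'a set)" and H: "oisole opm opm H"
    and n: "has_length (UNIV :: 'a set) n" and "n > 0"
  shows "poset_connected (UNIV :: 'b set) \<and> order_iso_sets (UNIV :: 'a set) (UNIV :: 'b set)"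
proof -
  have Pc: "(x, y) \<in> conn" for x y :: 'a using P by (simp add: poset_connected_UNIV)
  define G where "G = inv_into opm H"
  have G: "oisole opm opm G" unfolding G_def by (rule oiso_inv[OF H])
  have GH: "G (H f) = f" if "mono f" for f
    unfolding G_def using H that by (intro inv_into_f_f) (auto simp: oiso_def bij_betw_def)
  obtain m where m: "has_length (UNIV :: 'b set) m" using has_length_exists[OF finQ UNIV_not_empty] .
  have nm: "n * card (UNIV :: 'a set) = m * card (UNIV :: 'b set)"
  proof (rule antisym)
    obtain u w :: 'a where "(u, w) \<in> ltr UNIV ^^ n" using n by (auto simp: has_length_def)
    from maps_chain_bound(1)[OF finQ m oisole_ltr_relpow[OF G const_maps_chain[OF finP this]]]
    show "n * card (UNIV :: 'a set) \<le> m * card (UNIV :: 'b set)" .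
    obtain u w :: 'b where "(u, w) \<in> ltr UNIV ^^ m" using m by (auto simp: has_length_def)
    from maps_chain_bound(1)[OF finP n oisole_ltr_relpow[OF H const_maps_chain[OF finQ this]]]
    show "m * card (UNIV :: 'b set) \<le> n * card (UNIV :: 'a set)" .
  qed
  have cards: "card (UNIV :: 'a set) > 0" "card (UNIV :: 'b set) > 0"
    using finP finQ by (auto simp: card_gt_0_iff)
  have "m > 0" using nm cards \<open>n > 0\<close> by (metis mult_is_0 not_gr0)
  obtain v w :: 'b where vw: "(v, w) \<in> ltr UNIV ^^ m" using m by (auto simp: has_length_def)
  note ends = longest_chain_ends_const[OF finP finQ P H n nm]
  \<comment> \<open>A path in P from \<open>u\<close> to \<open>u'\<close> is a path of constant
    maps. \<open>G\<close> carries it into Q^Q, and evaluation at \<open>v\<close> gives a path from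
    \<open>v\<close> to \<open>a\<close>.\<close>
  have bottoms: "(v, a) \<in> conn" if ab: "(a, b) \<in> ltr UNIV ^^ m" for a b :: 'b
  proof -
    obtain u where u: "H (\<lambda>_. v) = (\<lambda>_. u)" using ends[OF vw] by metis
    obtain u' where u': "H (\<lambda>_. a) = (\<lambda>_. u')" using ends[OF ab] by metis
    have "(u, x) \<in> conn \<Longrightarrow> (v, G (\<lambda>_. x) v) \<in> conn" for x
      unfolding conn_def
    proof (induction rule: rtrancl_induct)
      case base
      then show ?case using GH[of "\<lambda>_. v"] u by simp
    next
      case (step y z)
      have "(G (\<lambda>_. y) v, G (\<lambda>_. z) v) \<in> {(a, b). a \<le> b \<or> b \<le> a}"
        using step(2) oiso_le[OF G, of "\<lambda>_. y" "\<lambda>_. z"] oiso_le[OF G, of "\<lambda>_. z" "\<lambda>_. y"]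
        by (auto simp: le_fun_def)
      with step.IH show ?case by (rule rtrancl_into_rtrancl)
    qed
    from this[OF Pc, of u'] show ?thesis using GH[of "\<lambda>_. a"] u' by simp
  qed
  obtain u u' where u: "H (\<lambda>_. v) = (\<lambda>_. u)" "H (\<lambda>_. w) = (\<lambda>_. u')" using ends[OF vw] .
  have "v < w"
  proof -
    obtain k where "m = Suc k" using \<open>m > 0\<close> by (cases m) auto
    then obtain z where "(v, z) \<in> ltr UNIV ^^ k" "z < w" using vw by (auto simp: ltr_def)
    then show ?thesis using ltr_relpow_le by (blast intro: le_less_trans)
  qed
  then have "v \<le> w" by simp
  have Hc: "H f \<in> opm" if "mono f" for f using oiso_mem[OF H] that by simp
  have "u \<le> u'"
    using oiso_le[OF H, of "\<lambda>_. v" "\<lambda>_. w"] \<open>v \<le> w\<close> u by (simp add: le_fun_def)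
  have Hivl: "oisole (ivl_maps v w) (ivl_maps u u') H"
  proof (rule oisoI)
    have *: "H f \<in> ivl_maps u u' \<longleftrightarrow> f \<in> ivl_maps v w" if "mono f" for f
      using oiso_le[OF H, of "\<lambda>_. v" f] oiso_le[OF H, of f "\<lambda>_. w"] that Hc[OF that] u
      by (auto simp: ivl_maps_def le_fun_def)
    show "H f \<in> ivl_maps u u'" if "f \<in> ivl_maps v w" for f
      using that * by (simp add: ivl_maps_def)
    fix g assume g: "g \<in> ivl_maps u u'"
    then obtain f where "mono f" "H f = g" using oiso_surj[OF H, of g] by (auto simp: ivl_maps_def)
    then show "\<exists>f\<in>ivl_maps v w. H f = g" using * g by blast
  qed (use oiso_le[OF H] in \<open>auto simp: ivl_maps_def\<close>)
  \<comment> \<open>The interval is fixed, while the component to be decomposed stays free: first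
    that of \<open>v\<close>, later an arbitrary one.\<close>
  note dec = decomposition_central[OF finP finQ Pc oiso_inv[OF Hivl] \<open>u \<le> u'\<close> \<open>v < w\<close>]
  have finK: "finite (component q)" for q :: 'b by (rule finite_subset[OF subset_UNIV finQ])
  have fin_fact: "finite A \<and> finite B \<and> A \<noteq> {} \<and> B \<noteq> {}"
    if "oiso r K dle (A \<times> B) f" "finite K" "K \<noteq> {}"
    for r and K :: "'c set" and A :: "'d::order set" and B :: "'e::order set" and f
  proof -
    have "A \<times> B = f ` K" using that by (auto simp: oiso_def bij_betw_def)
    then have "finite (A \<times> B)" "A \<times> B \<noteq> {}" using that by auto
    then show ?thesis by (auto dest: finite_cartesian_productD1 finite_cartesian_productD2)
  qed
  define K where "K = component v"
  have ivlK: "{v..w} \<subseteq> K" unfolding K_def by (auto intro: conn_le)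

  obtain Y Z X \<phi> \<psi> where
    \<phi>: "oiso (\<lambda>x y. y \<le> x) (UNIV :: 'a set) dle (Y \<times> Z) (\<phi> :: 'a \<Rightarrow> 'b \<times> 'b)" and
    \<psi>: "oiso (\<lambda>x y. y \<le> x) K dle (X \<times> Z) (\<psi> :: 'b \<Rightarrow> 'a \<times> 'b)" and
    central: "\<And>t. central v w t \<Longrightarrow> \<exists>N\<ge>card Y. (v, t) \<in> ltr UNIV ^^ N"
    unfolding K_def using dec[of v] by metis
  have "v \<in> K" by (simp add: K_def)
  have ne: "finite Y" "finite Z" "finite X" "Y \<noteq> {}" "Z \<noteq> {}" "X \<noteq> {}"
    using fin_fact[OF \<phi> finP] fin_fact[OF \<psi> finK[of v, folded K_def]] \<open>v \<in> K\<close> by auto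
  obtain y where y: "has_length Y y" using has_length_exists ne by metis
  obtain z where z: "has_length Z z" using has_length_exists ne by metis
  obtain x where x: "has_length X x" using has_length_exists ne by metis
  have xzm: "x + z \<le> m"
  proof -
    obtain p q where "(p, q) \<in> ltr K ^^ (x + z)" using product_chain[OF \<psi> x z] by metis
    then have "(p, q) \<in> ltr UNIV ^^ (x + z)" by (rule ltr_relpow_between) simp
    then show ?thesis using has_length_le[OF m] by blast
  qed
  have nyz: "n \<le> y + z"
  proof -
    obtain p q :: 'a where "(p, q) \<in> ltr UNIV ^^ n" using n by (auto simp: has_length_def)
    then show ?thesis using product_chain_bound[OF \<phi> y z] by blast
  qed
  have yX: "y < card Y" and xX: "x < card X" using has_length_less_card x y ne by auto
  have \<psi>_le: "dle (\<psi> b) (\<psi> a) \<longleftrightarrow> a \<le> b" if "a \<in> {v..w}" "b \<in> {v..w}" for a b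
    using oiso_le[OF \<psi>] that ivlK by (meson subsetD)
  have \<psi>_mem: "\<psi> a \<in> X \<times> Z" if "a \<in> {v..w}" for a
    using oiso_mem[OF \<psi>] that ivlK by blast
  have "fst (\<psi> v) = fst (\<psi> w)"
  proof (rule ccontr)
    assume neq: "fst (\<psi> v) \<noteq> fst (\<psi> w)"
    have surj: "\<exists>c\<in>{v..w}. \<psi> c = a" if a: "a \<in> X \<times> Z" "dle (\<psi> w) a" "dle a (\<psi> v)" for a
    proof -
      obtain c where c: "c \<in> K" "\<psi> c = a" using oiso_surj[OF \<psi> a(1)] .
      then have "c \<in> {v..w}"
        using a(2,3) oiso_le[OF \<psi> c(1) \<open>v \<in> K\<close>] oiso_le[OF \<psi> _ c(1), of w] ivlK \<open>v \<le> w\<close> by auto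
      then show ?thesis using c by blast
    qed
    have "\<exists>t. central v w t \<and> (\<forall>N. (v, t) \<in> ltr UNIV ^^ N \<longrightarrow> N \<le> x)"
      by (rule central_factor[OF finQ \<open>v \<le> w\<close> \<psi>_mem \<psi>_le surj x neq])
    then obtain t where t: "central v w t" "\<And>N. (v, t) \<in> ltr UNIV ^^ N \<Longrightarrow> N \<le> x" by blast
    then have "card Y \<le> x" using central[OF t(1)] by force
    \<comment> \<open>Here n \<le> y + z < |Y| + z \<le> x + z \<le> m and |Y| \<le> x < |X|,
      whereas m|K| \<le> m|Q| = n|P| yields m|X| \<le> n|Y|.\<close>
    then have "n < m" and YX: "card Y < card X" using yX xX xzm nyz by auto
    have "m * card K \<le> n * card (UNIV :: 'a set)"
      using nm card_mono[OF finQ subset_UNIV, of K] by simp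
    then have "m * (card X * card Z) \<le> n * (card Y * card Z)"
      using oiso_card[OF \<phi>] oiso_card[OF \<psi>] by (simp add: card_cartesian_product)
    then have "m * card X \<le> n * card Y"
      using ne by (simp add: mult.assoc[symmetric] card_gt_0_iff)
    moreover have "n * card Y < m * card X"
      using \<open>n < m\<close> YX by (intro mult_strict_mono) auto
    ultimately show False by simp
  qed
  from snd_chain[OF \<psi>_le \<psi>_mem this vw] have "m \<le> z"
    using has_length_le[OF z] \<psi>_mem[of v] \<open>v \<le> w\<close> by (auto simp: mem_Times_iff)
  then have "x = 0" using xzm by simp
  \<comment> \<open>As \<open>X\<close> has length 0, its comparable points coincide, so the first
    coordinate is constant on the connected set \<open>K\<close> and \<open>X\<close> is a
    point.\<close>
  have fst_\<psi>: "fst (\<psi> a) = fst (\<psi> v)" if "a \<in> K" for a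
  proof -
    have "(v, a) \<in> {(a, b). a \<le> b \<or> b \<le> a}\<^sup>*" using that by (simp add: K_def conn_def)
    then show ?thesis
    proof (induction rule: rtrancl_induct)
      case (step b c)
      have bc: "b \<in> K" "c \<in> K"
        unfolding K_def conn_def using step.hyps by (auto intro: rtrancl_into_rtrancl)
      have anti: "\<not> s < t" if "s \<in> X" "t \<in> X" for s t
        using has_length_le[OF x that(1), of t 1] that \<open>x = 0\<close> by (auto simp: ltr_def)
      have "fst (\<psi> b) \<in> X" "fst (\<psi> c) \<in> X" using oiso_mem[OF \<psi>] bc by (auto simp: mem_Times_iff)
      moreover have "fst (\<psi> b) \<le> fst (\<psi> c) \<or> fst (\<psi> c) \<le> fst (\<psi> b)"
        using step.hyps(2) oiso_geD[OF \<psi>] bc by auto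
      ultimately show ?case using anti step.IH by (auto simp: le_less)
    qed simp
  qed
  define x0 where "x0 = fst (\<psi> v)"
  have X: "X = {x0}"
  proof -
    have "a = x0" if aX: "a \<in> X" for a
    proof -
      obtain b where "b \<in> Z" using ne by blast
      then obtain c where "c \<in> K" "\<psi> c = (a, b)" using oiso_surj[OF \<psi>, of "(a, b)"] aX by blast
      then show ?thesis using fst_\<psi>[of c] by (simp add: x0_def)
    qed
    then show ?thesis using ne by blast
  qed
  have \<psi>K: "a \<le> b \<longleftrightarrow> snd (\<psi> a) \<le> snd (\<psi> b)" if "a \<in> K" "b \<in> K" for a b
    using oiso_geD[OF \<psi> that] fst_\<psi> that by simp
  obtain y0 where y0: "y0 \<in> Y" using ne by blast
  \<comment> \<open>\<open>\<theta>\<close> maps \<open>K\<close> onto the slice of P over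
    \<open>y0\<close>. Both decompositions reverse the first factor only, so on \<open>Z\<close> the
    orders of \<open>K\<close> and P agree.\<close>
  define \<theta> where "\<theta> = (\<lambda>a. inv_into UNIV \<phi> (y0, snd (\<psi> a)))"
  have \<phi>\<theta>: "\<phi> (\<theta> a) = (y0, snd (\<psi> a))" if "a \<in> K" for a
  proof -
    have "(y0, snd (\<psi> a)) \<in> \<phi> ` UNIV"
      using \<phi> y0 oiso_mem[OF \<psi> that] by (auto simp: oiso_def bij_betw_def mem_Times_iff)
    then show ?thesis unfolding \<theta>_def by (rule f_inv_into_f)
  qed
  have \<theta>: "\<theta> a \<le> \<theta> b \<longleftrightarrow> a \<le> b" if "a \<in> K" "b \<in> K" for a b
    using oiso_geD[OF \<phi>, of "\<theta> a" "\<theta> b"] that \<psi>K by (simp add: \<phi>\<theta>)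

  have "(v, q) \<in> conn" for q
  proof -
    obtain Y' Z' X' \<phi>' \<psi>' where
      \<phi>': "oiso (\<lambda>x y. y \<le> x) (UNIV :: 'a set) dle (Y' \<times> Z') (\<phi>' :: 'a \<Rightarrow> 'b \<times> 'b)" and
      \<psi>': "oiso (\<lambda>x y. y \<le> x) (component q) dle (X' \<times> Z') (\<psi>' :: 'b \<Rightarrow> 'a \<times> 'b)" and
      central': "\<And>t. central v w t \<Longrightarrow> \<exists>N\<ge>card Y'. (v, t) \<in> ltr UNIV ^^ N"
      using dec[of q] by metis
    have "component q \<noteq> {}" using conn_refl by blast
    then have ne': "finite Y'" "finite Z'" "finite X'" "Y' \<noteq> {}" "Z' \<noteq> {}" "X' \<noteq> {}"
      using fin_fact[OF \<phi>' finP] fin_fact[OF \<psi>' finK[of q]] by auto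
    obtain y' where y': "has_length Y' y'" using has_length_exists ne' by metis
    obtain z' where z': "has_length Z' z'" using has_length_exists ne' by metis
    obtain x' where x': "has_length X' x'" using has_length_exists ne' by metis
    \<comment> \<open>This views \<open>{v..w}\<close> inside P and reads it in the coordinates of
      the decomposition obtained from the component of \<open>q\<close>.\<close>
    define \<chi> where "\<chi> a = \<phi>' (\<theta> a)" for a
    have \<chi>_le: "dle (\<chi> b) (\<chi> a) \<longleftrightarrow> a \<le> b" if "a \<in> {v..w}" "b \<in> {v..w}" for a b
      unfolding \<chi>_def using oiso_le[OF \<phi>'] \<theta> that ivlK by (metis UNIV_I subsetD)
    have \<chi>_mem: "\<chi> a \<in> Y' \<times> Z'" for a
      unfolding \<chi>_def using oiso_mem[OF \<phi>'] by blast
    have surj: "\<exists>c\<in>{v..w}. \<chi> c = a" if a: "a \<in> Y' \<times> Z'" "dle (\<chi> w) a" "dle a (\<chi> v)" for a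
    proof -
      obtain p where p: "\<phi>' p = a" using oiso_surj[OF \<phi>' a(1)] by metis
      have "w \<in> K" using ivlK \<open>v \<le> w\<close> by auto
      have vpw: "\<theta> v \<le> p" "p \<le> \<theta> w"
        using oiso_le[OF \<phi>', of p "\<theta> v"] oiso_le[OF \<phi>', of "\<theta> w" p] a(2,3) p by (auto simp: \<chi>_def)
      \<comment> \<open>Both ends lie in the slice over \<open>y0\<close>, so everything between
        them in P does too. Thus \<open>\<theta>\<close> maps \<open>{v..w}\<close> onto a full
        interval of P.\<close>
      then have pp: "fst (\<phi> p) = y0"
        using oiso_geD[OF \<phi>, of "\<theta> v" p] oiso_geD[OF \<phi>, of p "\<theta> w"] \<phi>\<theta> \<open>v \<in> K\<close> \<open>w \<in> K\<close> by auto
      have "(x0, snd (\<phi> p)) \<in> X \<times> Z" using X oiso_mem[OF \<phi>, of p] by (auto simp: mem_Times_iff)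
      then obtain c where c: "c \<in> K" "\<psi> c = (x0, snd (\<phi> p))" using oiso_surj[OF \<psi>] by metis
      have "\<phi> (\<theta> c) = \<phi> p" using \<phi>\<theta>[OF c(1)] c(2) pp by (simp add: prod_eq_iff)
      then have cp: "\<theta> c = p" using oiso_eq[OF \<phi>] by blast
      then have "c \<in> {v..w}" using vpw \<theta> c(1) \<open>v \<in> K\<close> \<open>w \<in> K\<close> by auto
      then show ?thesis using cp p by (auto simp: \<chi>_def)
    qed
    have "fst (\<chi> v) = fst (\<chi> w)"
    proof (rule ccontr)
      assume neq: "fst (\<chi> v) \<noteq> fst (\<chi> w)"
      \<comment> \<open>Chains from \<open>v\<close> to this \<open>t\<close> have at most y' < |Y'|
        steps, while \<open>central'\<close> supplies one with at least |Y'|.\<close>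
      have "\<exists>t. central v w t \<and> (\<forall>N. (v, t) \<in> ltr UNIV ^^ N \<longrightarrow> N \<le> y')"
        by (rule central_factor[OF finQ \<open>v \<le> w\<close> \<chi>_mem \<chi>_le surj y' neq])
      then obtain t where t: "central v w t" "\<And>N. (v, t) \<in> ltr UNIV ^^ N \<Longrightarrow> N \<le> y'" by blast
      then have "card Y' \<le> y'" using central'[OF t(1)] by force
      then show False using has_length_less_card[OF y'] ne' by simp
    qed
    from snd_chain[OF \<chi>_le \<chi>_mem this vw] have "m \<le> z'"
      using has_length_le[OF z'] \<chi>_mem[of v] by (auto simp: mem_Times_iff)
    \<comment> \<open>The component of \<open>q\<close> contains a chain of the maximal length m,
      and \<open>bottoms\<close> links its lower end to \<open>v\<close>.\<close>
    obtain a b where ab: "a \<in> component q" "(a, b) \<in> ltr (component q) ^^ (x' + z')"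
      using product_chain[OF \<psi>' x' z'] by metis
    then have ab': "(a, b) \<in> ltr UNIV ^^ (x' + z')" by (intro ltr_relpow_between[OF ab(2)]) simp
    then have "x' + z' = m" using has_length_le[OF m _ ab'] \<open>m \<le> z'\<close> by simp
    then have "(v, a) \<in> conn" using bottoms ab' by simp
    then show ?thesis using ab(1) by (auto intro: conn_trans conn_sym)
  qed
  note vq = this
  have conn: "poset_connected (UNIV :: 'b set)"
    unfolding poset_connected_UNIV using vq by (blast intro: conn_trans conn_sym)
  have KU: "K = UNIV" using vq by (auto simp: K_def)
  have "m \<le> n"
  proof -
    have "(\<theta> v, \<theta> w) \<in> ltr UNIV ^^ m"
      using \<theta> KU by (intro relpow_map[OF _ vw]) (auto simp: ltr_def less_le_not_le)
    then show ?thesis using has_length_le[OF n] by blast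
  qed
  have "card Y = 1"
  proof -
    \<comment> \<open>Now |Q| = |Z| and |P| = |Y||Z|, so n|P| = m|Q| becomes n|Y| = m, with m \<le>
      n.\<close>
    have "n * (card Y * card Z) = m * card Z"
      using nm oiso_card[OF \<phi>] oiso_card[OF \<psi>] KU X by (simp add: card_cartesian_product)
    then have "n * card Y = m" using ne by (simp add: mult.assoc[symmetric])
    then have "n * card Y \<le> n * 1" using \<open>m \<le> n\<close> by simp
    then have "card Y \<le> 1" using \<open>n > 0\<close> by (metis mult_le_cancel1)
    then show ?thesis using ne by (simp add: card_gt_0_iff le_antisym Suc_leI)
  qed
  then have Y: "Y = {y0}" using y0 by (auto simp: card_1_singleton_iff)
  have "oisole UNIV UNIV \<theta>"
  proof (rule oisoI)
    fix p :: 'a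
    have p: "\<phi> p \<in> {y0} \<times> Z" using oiso_mem[OF \<phi>, of p] Y by simp
    then have "(x0, snd (\<phi> p)) \<in> X \<times> Z" using X by (auto simp: mem_Times_iff)
    then obtain c where c: "c \<in> K" "\<psi> c = (x0, snd (\<phi> p))" using oiso_surj[OF \<psi>] by metis
    have "\<phi> (\<theta> c) = \<phi> p" using \<phi>\<theta>[OF c(1)] c(2) p by (auto simp: prod_eq_iff)
    then show "\<exists>c\<in>UNIV. \<theta> c = p" using oiso_eq[OF \<phi>] by blast
  qed (use \<theta> KU in auto)
  then have "order_iso_sets (UNIV :: 'a set) (UNIV :: 'b set)"
    unfolding order_iso_sets_iff using oiso_inv by blast
  with conn show ?thesis by blast
qed

theorem theorem10:
  assumes "finite (UNIV :: 'a::order set)"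
      and "finite (UNIV :: 'b::order set)"
      and "poset_connected (UNIV :: 'a set)"
      and "order_iso_sets (order_preserving_maps :: ('a \<Rightarrow> 'a) set)
                          (order_preserving_maps :: ('b \<Rightarrow> 'b) set)"
  shows "poset_connected (UNIV :: 'b set) \<and> order_iso_sets (UNIV :: 'a set) (UNIV :: 'b set)"
proof -
  obtain G where G: "oisole (opm :: ('a \<Rightarrow> 'a) set) (opm :: ('b \<Rightarrow> 'b) set) G"
    using assms(4) by (auto simp: order_iso_sets_iff)
  obtain n where n: "has_length (UNIV :: 'a set) n" using has_length_exists[OF assms(1) UNIV_not_empty] .
  show ?thesis
  proof (cases "n = 0")
    case False
    then show ?thesis using connected_iso_of_length_pos[OF assms(1-3) oiso_inv[OF G] n] by simp
  next
    \<comment> \<open>A connected poset of length 0 is a point, so P^P and Q^Q have one element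
      each. The constant maps of Q then coincide, and Q is a point.\<close>
    case True
    have "a = b" if "a \<le> b" for a b :: 'a
      using has_length_le[OF n _, of a b 1] that True by (auto simp: ltr_def less_le)
    then have one: "a = b" for a b :: 'a
      using assms(3) conn_invariant[of a b id] by (auto simp: poset_connected_UNIV)
    have "a = b" for a b :: 'b
    proof -
      obtain f where f: "f \<in> opm" "G f = (\<lambda>_. a)" using oiso_surj[OF G, of "\<lambda>_. a"] by auto
      obtain g where g: "g \<in> opm" "G g = (\<lambda>_. b)" using oiso_surj[OF G, of "\<lambda>_. b"] by auto
      have "f = g" using one by blast
      then show ?thesis using f g by (metis (full_types))
    qed
    then have two: "a = undefined" for a :: 'b by blast
    have "oisole (UNIV :: 'a set) (UNIV :: 'b set) (\<lambda>_. undefined)"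
    proof (rule oisoI)
      show "\<exists>x\<in>UNIV. undefined = y" for y :: 'b using two[of y] by simp
      show "undefined \<le> (undefined :: 'b) \<longleftrightarrow> x \<le> y" for x y :: 'a using one[of x y] by simp
    qed (use one in auto)
    moreover have "(x, y) \<in> conn" for x y :: 'b using two[of x] two[of y] by simp
    ultimately show ?thesis by (auto simp: order_iso_sets_iff poset_connected_UNIV)
  qed
qed

end
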